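(* For every complex number $w$ with $|w|<1$ the following equality holds: $$\sum_{k=0}^{\infty}\sum_{\ell=1}^{a_k}w^kY_{k,\ell}(\theta)Y_{k,\ell}(\theta')=\sum_{k=0}^{\infty}w^kZ_\theta^{(k)}(\theta')=\frac{1-w^2}{(1-2w\langle\theta,\theta'\rangle+w^2)^{\frac d2}},$$ where $Z_\theta^{(k)}(\theta')$ are the zonal harmonics. Put $\cos\phi=\langle\theta,\theta'\rangle$. For $d=2$ we have $$K_P(w,\theta,\theta')=\frac1{2\pi}+\frac1\pi\sum_{k=1}^{\infty}w^k\frac{\cos k\phi}{\pi}=\frac1{2\pi}\frac{1-w^2}{1-2w\cos\phi+w^2},$$ and for $d>2$, $$K_P(w,\theta,\theta')=\sum_{k=0}^{\infty}w^kc_{k,d}P_k^{\lambda}(\cos\phi),$$ where $$c_{k,d}=\frac1{\omega_{d-1}}\frac{2k+d-2}{d-2},\qquad\lambda=\frac{d-2}2,$$ and $P_k^\lambda$ are the Legendre polynomials. Hence, the $r$-complexification of the Poisson kernel $K_P(r,\theta,\theta')$ is given by $$K_P(w,\theta,\theta')=\frac{1-w^2}{(1-2w\langle\theta,\theta'\rangle+w^2)^{\frac d2}}=\frac{1-w^2}{\left((1-e^{i\phi}w)(1-e^{-i\phi}w)\right)^{d/2}}.$$ The Cauchy type kernel $K(\zeta,\theta';z,\theta)$ is related to the $r$-complexification of the Poisson kernel by the equality $$K(\zeta,\theta';z,\theta)=\frac1{1-\zeta^2z^2}K_P(\zeta z,\theta,\theta')=\frac1{(1-2\zeta z\langle\theta,\theta'\rangle+\zeta^2z^2)^{\frac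 d2}}.$$
   Context: $\mathbb{S}^{d-1}$ is the unit sphere of $\mathbb{R}^d$, endowed with the rotation invariant measure $d\theta$; $\theta,\theta'\in\mathbb{S}^{d-1}$, and $\langle\cdot,\cdot\rangle$ is the Euclidean inner product. $\mathcal{H}_k(\mathbb{R}^d)$ is the space of harmonic homogeneous complex-valued polynomials of degree $k$, $a_k=\dim\mathcal{H}_k(\mathbb{R}^d)$, and $Y_{k,\ell}:\mathbb{R}^d\to\mathbb{C}$, $\ell=1,\dots,a_k$, is an orthonormal basis of $\mathcal{H}_k(\mathbb{R}^d)$ with respect to $\int_{\mathbb{S}^{d-1}}f(\theta)\overline{g(\theta)}\,d\theta$. $Z_\theta^{(k)}$ is the zonal harmonic of degree $k$ with pole $\theta$, i.e. the reproducing kernel at $\theta$ of the spherical harmonics of degree $k$ in $L^2(\mathbb{S}^{d-1},d\theta)$. The constant $\omega_{d-1}$ is the surface area of $\mathbb{S}^{d-1}$. The polynomials $P_k^\lambda$ are given by $(1-2rt+r^2)^{-\lambda}=\sum_{k\ge0}P_k^\lambda(t)r^k$. The Poisson kernel is, for $0\le r<1$, $$K_P(r,\theta,\theta')=\frac{1-r^2}{|\theta-r\theta'|^d}=\sum_{k=0}^{\infty}\sum_{\ell=1}^{a_k}r^kY_{k,\ell}(\theta)Y_{k,\ell}(\theta'),$$ and its $r$-complexification $K_P(w,\theta,\theta')$, $|w|<1$, is its analytic continuation from the real variable $r$ to the complex variable $w$; the powers $d/2$ are the corresponding analytic branches, equal to $1$ at $w=0$. The Cauchy type kernel is $$K(\zeta,\theta';z,\theta)=\sum_{j\ge0}\sum_{k=0}^{\infty}\sum_{\ell=1}^{a_k}\zeta^{2j+k}Y_{k,\ell}(\theta')\,z^{2j+k}Y_{k,\ell}(\theta),$$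 which converges absolutely for complex $\zeta,z$ with $|\zeta z|<1$.
   Formalization: Products Y(θ)Y(θ') are read as Y(θ) times the conjugate of Y(θ'); the spurious second 1/π in the d=2 series is dropped; for an invariant measure of total mass m, the closed forms carry 1/m and the d=2 and d>2 formulas carry ω_{d-1}/m, since the printed normalisations conflict. *)

theory Defs
  imports "HOL-Analysis.Analysis" "HOL-Library.Function_Algebras"
begin

text \<open>
  Conventions. The ambient space is \<open>real^'d\<close> with \<open>d = CARD('d)\<close>. The normalisation of
  the rotation invariant measure \<open>d\<theta>\<close> on the sphere is left free: formulas for the Poisson
  kernel are customarily written either for total mass \<open>1\<close> (closed form without a prefactor)
  or for surface measure (prefactors \<open>1/(2\<pi>)\<close> and \<open>1/\<omega>\<^sub>d\<^sub>-\<^sub>1\<close>). Both normalisations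
  are covered, by letting the total mass appear explicitly.

  The basis \<open>Y\<^sub>k\<^sub>,\<^sub>l\<close> is complex valued, so the reproducing kernel is
  \<open>\<Sum>\<^sub>l Y\<^sub>k\<^sub>,\<^sub>l(\<theta>) cnj (Y\<^sub>k\<^sub>,\<^sub>l(\<theta>'))\<close>; the conjugation disappears exactly when
  the \<open>Y\<^sub>k\<^sub>,\<^sub>l\<close> are real valued.
\<close>

section \<open>Measures on the sphere\<close>

definition rotation_invariant :: "(real^'d) measure \<Rightarrow> bool" where
  "rotation_invariant M \<longleftrightarrow>
     sets M = sets (restrict_space borel (sphere 0 1)) \<and>
     finite_measure M \<and> emeasure M (space M) \<noteq> 0 \<and>
     (\<forall>Q. rotation_matrix Q \<longrightarrow> distr M M (\<lambda>x. Q *v x) = M)"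

text \<open>Surface measure as cone measure: \<open>A\<close> has measure \<open>d\<close> times the volume of the cone
  \<open>{r x | 0 < r < 1, x \<in> A}\<close>.\<close>

definition surface_measure :: "(real^'d) measure" where
  "surface_measure =
     scale_measure (of_nat CARD('d))
       (distr (restrict_space lborel (ball 0 1 - {0})) (restrict_space borel (sphere 0 1))
          (\<lambda>x. x /\<^sub>R norm x))"

text \<open>The constant \<open>\<omega>\<^sub>d\<^sub>-\<^sub>1\<close>.\<close>

definition sphere_area :: "'d::finite itself \<Rightarrow> real" where
  "sphere_area _ = measure (surface_measure :: (real^'d) measure) (sphere 0 1)"


section \<open>Spherical harmonics\<close>

definition partial_deriv :: "'d \<Rightarrow> (real^'d \<Rightarrow> complex) \<Rightarrow> real^'d \<Rightarrow> complex" where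
  "partial_deriv i f x = vector_derivative (\<lambda>t. f (x + t *\<^sub>R axis i 1)) (at 0)"

definition laplacian :: "(real^'d \<Rightarrow> complex) \<Rightarrow> real^'d \<Rightarrow> complex" where
  "laplacian f x = (\<Sum>i\<in>UNIV. partial_deriv i (partial_deriv i f) x)"

definition harmonic_space :: "nat \<Rightarrow> (real^'d \<Rightarrow> complex) set" where
  "harmonic_space k =
     {p. polynomial_function p \<and>
         (\<forall>c x. p (c *\<^sub>R x) = of_real c ^ k * p x) \<and>
         (\<forall>x. laplacian p x = 0)}"

definition cscale :: "complex \<Rightarrow> ('a \<Rightarrow> complex) \<Rightarrow> 'a \<Rightarrow> complex" where
  "cscale c f = (\<lambda>x. c * f x)"

interpretation cfun: vector_space "cscale :: complex \<Rightarrow> ('a \<Rightarrow> complex) \<Rightarrow> 'a \<Rightarrow> complex"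
  by unfold_locales (auto simp: cscale_def fun_eq_iff algebra_simps)

definition harm_dim :: "'d::finite itself \<Rightarrow> nat \<Rightarrow> nat" where
  "harm_dim _ k = cfun.dim (harmonic_space k :: (real^'d \<Rightarrow> complex) set)"

definition orthonormal_harmonics ::
  "(real^'d) measure \<Rightarrow> nat \<Rightarrow> (nat \<Rightarrow> real^'d \<Rightarrow> complex) \<Rightarrow> bool" where
  "orthonormal_harmonics M k Y \<longleftrightarrow>
     (\<forall>l\<in>{1..harm_dim TYPE('d) k}. \<forall>l'\<in>{1..harm_dim TYPE('d) k}.
        (\<integral>x. Y l x * cnj (Y l' x) \<partial>M) = (if l = l' then 1 else 0)) \<and>
     cfun.span (Y ` {1..harm_dim TYPE('d) k}) = harmonic_space k"

text \<open>The function reproducing the value at \<open>\<theta>\<close> in the space of spherical harmonics of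
  degree \<open>k\<close>, extended from the sphere to a homogeneous polynomial.\<close>

definition zonal :: "(real^'d) measure \<Rightarrow> nat \<Rightarrow> real^'d \<Rightarrow> real^'d \<Rightarrow> complex" where
  "zonal M k \<theta> =
     (THE Z. Z \<in> harmonic_space k \<and>
        (\<forall>f\<in>harmonic_space k. f \<theta> = (\<integral>x. f x * cnj (Z x) \<partial>M)))"

definition P_poly :: "real \<Rightarrow> nat \<Rightarrow> real \<Rightarrow> real" where
  "P_poly a k t =
     (THE p. \<forall>\<^sub>F r in nhds 0. (\<lambda>n. p n * r ^ n) sums ((1 - 2 * r * t + r\<^sup>2) powr (- a))) k"


section \<open>Analytic continuation to the unit disc\<close>

text \<open>The analytic branch of \<open>g\<^sup>a\<close> on the unit disc with value \<open>1\<close> at \<open>0\<close>, for zero-free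
  holomorphic \<open>g\<close> with \<open>g 0 = 1\<close>.\<close>

definition disc_power :: "(complex \<Rightarrow> complex) \<Rightarrow> real \<Rightarrow> complex \<Rightarrow> complex" where
  "disc_power g a w =
     exp (of_real a *
       (SOME L. L holomorphic_on ball 0 1 \<and> L 0 = 0 \<and> (\<forall>u\<in>ball 0 1. exp (L u) = g u)) w)"

definition r_complexification :: "(real \<Rightarrow> real) \<Rightarrow> complex \<Rightarrow> complex" where
  "r_complexification f =
     (SOME F. F holomorphic_on ball 0 1 \<and> (\<forall>r\<in>{0..<1}. F (of_real r) = of_real (f r)))"


section \<open>The kernels\<close>

definition poisson_kernel :: "(real^'d) measure \<Rightarrow> real \<Rightarrow> real^'d \<Rightarrow> real^'d \<Rightarrow> real" where
  "poisson_kernel M r \<theta> \<theta>' =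
     1 / measure M (space M) * ((1 - r\<^sup>2) / norm (\<theta> - r *\<^sub>R \<theta>') ^ CARD('d))"

definition complex_poisson_kernel ::
  "(real^'d) measure \<Rightarrow> complex \<Rightarrow> real^'d \<Rightarrow> real^'d \<Rightarrow> complex" where
  "complex_poisson_kernel M w \<theta> \<theta>' = r_complexification (\<lambda>r. poisson_kernel M r \<theta> \<theta>') w"

definition cauchy_term ::
  "(nat \<Rightarrow> nat \<Rightarrow> real^'d \<Rightarrow> complex) \<Rightarrow>
     complex \<Rightarrow> real^'d \<Rightarrow> complex \<Rightarrow> real^'d \<Rightarrow> nat \<times> nat \<times> nat \<Rightarrow> complex" where
  "cauchy_term Y \<zeta> \<theta>' z \<theta> = (\<lambda>(j, k, l).
     \<zeta> ^ (2 * j + k) * cnj (Y k l \<theta>') * (z ^ (2 * j + k) * Y k l \<theta>))"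

definition cauchy_index :: "'d::finite itself \<Rightarrow> (nat \<times> nat \<times> nat) set" where
  "cauchy_index _ = (SIGMA j:UNIV. SIGMA k:UNIV. {1..harm_dim TYPE('d) k})"

definition cauchy_kernel ::
  "(nat \<Rightarrow> nat \<Rightarrow> real^'d \<Rightarrow> complex) \<Rightarrow>
     complex \<Rightarrow> real^'d \<Rightarrow> complex \<Rightarrow> real^'d \<Rightarrow> complex" where
  "cauchy_kernel Y \<zeta> \<theta>' z \<theta> = infsum (cauchy_term Y \<zeta> \<theta>' z \<theta>) (cauchy_index TYPE('d))"

end

theory Submission
  imports Defs "HOL-Complex_Analysis.Complex_Analysis"
begin

text \<open>
  For unit vectors write \<open>(1 - r\<^sup>2) / |\<theta> - r x|\<^sup>d = \<Sum>\<^sub>n r\<^sup>n G\<^sub>n\<close>. The coefficient \<open>G\<^sub>n\<close>, made homogeneous in \<open>x\<close>,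
  is a harmonic polynomial of degree \<open>n\<close>: the generating function is annihilated by the Laplacian, an
  identity of formal power series in \<open>r\<close>. Harmonics of different degrees are orthogonal for every
  rotation invariant \<open>M\<close>, because the infinitesimal rotations \<open>x\<^sub>i \<partial>\<^sub>j - x\<^sub>j \<partial>\<^sub>i\<close> are skew-adjoint for \<open>M\<close>
  and the sum of their squares acts on degree \<open>k\<close> by a scalar that determines \<open>k\<close>. Hence the integral of
  the Poisson kernel against a harmonic \<open>f\<close> of degree \<open>k\<close> is \<open>r\<^sup>k \<integral> G\<^sub>k f dM\<close>; as \<open>r\<close> tends to \<open>1\<close> the kernel is
  an approximate identity, so \<open>\<integral> G\<^sub>k f dM = M(S) f(\<theta>)\<close>. Expanding \<open>G\<^sub>k\<close> in the orthonormal basis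
  identifies it with \<open>M(S) \<Sum>\<^sub>l Y\<^sub>k\<^sub>,\<^sub>l(x) cnj (Y\<^sub>k\<^sub>,\<^sub>l(\<theta>))\<close>.
\<close>

unbundle no fps_syntax

section \<open>Derivatives of polynomial functions\<close>

text \<open>Of the measure \<open>M\<close>, only finiteness, nonvanishing and invariance are
  available, so there is neither a Green formula nor an explicit surface integral: facts about
  integrals come from rotating the integrand by small angles. Even the mass of the kernel is
  obtained this way, from the constant harmonic.

  The kernel appears in two guises. As a formal series its coefficients are defined for every
  \<open>x\<close>, and differentiating them is finite algebra with no interchange of limits. As an
  analytic function of \<open>w\<close> on the unit disc it supplies convergence and bounds uniform
  in \<open>x\<close>. A first-order linear differential equation identifies the two.

  Powers, continuations, zonal harmonics and \<open>P_poly\<close> are introduced by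
  \<open>SOME\<close> or \<open>THE\<close>, so each needs a uniqueness argument before it can be
  computed.

  The kernel has exponent \<open>d/2\<close>, the Legendre polynomials have \<open>(d-2)/2\<close>.
  The operator \<open>X d/dX + a\<close> raises the exponent \<open>a\<close> of the generating
  function by one, and this shift is the origin of \<open>(2k+d-2)/(d-2)\<close>.\<close>

lemma real_polynomial_function_has_derivative:
  fixes p :: "real^'d \<Rightarrow> real"
  assumes "real_polynomial_function p"
  shows "\<exists>q. (\<forall>i. real_polynomial_function (q i)) \<and>
    (\<forall>x. (p has_derivative (\<lambda>v. \<Sum>i\<in>UNIV. v $ i * q i x)) (at x))"
  using assms
proof induction
  case (linear f)
  have f: "f v = (\<Sum>i\<in>UNIV. v $ i * f (axis i 1))" for v
  proof -
    have "f v = f (\<Sum>i\<in>UNIV. v $ i *\<^sub>R axis i 1)"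
      using basis_expansion[of v] by (simp add: scalar_mult_eq_scaleR)
    also have "\<dots> = (\<Sum>i\<in>UNIV. v $ i * f (axis i 1))"
      using linear by (simp add: bounded_linear.linear linear_sum linear_cmul)
    finally show ?thesis .
  qed
  show ?case
  proof (intro exI[of _ "\<lambda>i x. f (axis i 1)"] conjI allI)
    fix x
    have "(f has_derivative f) (at x)"
      using linear by (rule bounded_linear_imp_has_derivative)
    moreover have "f = (\<lambda>v. \<Sum>i\<in>UNIV. v $ i * f (axis i 1))"
      using f by blast
    ultimately show "(f has_derivative (\<lambda>v. \<Sum>i\<in>UNIV. v $ i * f (axis i 1))) (at x)"
      by simp
  qed blast
next
  case (const c)
  then show ?case
    by (intro exI[of _ "\<lambda>i x. 0"]) (auto intro: real_polynomial_function.intros(2))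
next
  case (add f g)
  then obtain qf qg where
    "\<And>i. real_polynomial_function (qf i)" "\<And>i. real_polynomial_function (qg i)"
    "\<And>x. (f has_derivative (\<lambda>v. \<Sum>i\<in>UNIV. v $ i * qf i x)) (at x)"
    "\<And>x. (g has_derivative (\<lambda>v. \<Sum>i\<in>UNIV. v $ i * qg i x)) (at x)"
    by blast
  then show ?case
    by (intro exI[of _ "\<lambda>i x. qf i x + qg i x"] conjI allI real_polynomial_function.intros(3))
      (auto simp: algebra_simps sum.distrib intro!: derivative_eq_intros)
next
  case (mult f g)
  then obtain qf qg where *:
    "\<And>i. real_polynomial_function (qf i)" "\<And>i. real_polynomial_function (qg i)"
    "\<And>x. (f has_derivative (\<lambda>v. \<Sum>i\<in>UNIV. v $ i * qf i x)) (at x)"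
    "\<And>x. (g has_derivative (\<lambda>v. \<Sum>i\<in>UNIV. v $ i * qg i x)) (at x)"
    by blast
  show ?case
  proof (intro exI[of _ "\<lambda>i x. f x * qg i x + qf i x * g x"] conjI allI)
    show "real_polynomial_function (\<lambda>x. f x * qg i x + qf i x * g x)" for i
      using * mult.hyps by (intro real_polynomial_function.intros(3) real_polynomial_function.intros(4)) auto
    fix x
    have "((\<lambda>x. f x * g x) has_derivative
      (\<lambda>v. f x * (\<Sum>i\<in>UNIV. v $ i * qg i x) + (\<Sum>i\<in>UNIV. v $ i * qf i x) * g x)) (at x)"
      by (intro has_derivative_mult *)
    also have "(\<lambda>v. f x * (\<Sum>i\<in>UNIV. v $ i * qg i x) + (\<Sum>i\<in>UNIV. v $ i * qf i x) * g x)
      = (\<lambda>v. \<Sum>i\<in>UNIV. v $ i * (f x * qg i x + qf i x * g x))"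
      by (simp add: sum_distrib_left sum_distrib_right sum.distrib algebra_simps)
    finally show "((\<lambda>x. f x * g x) has_derivative
      (\<lambda>v. \<Sum>i\<in>UNIV. v $ i * (f x * qg i x + qf i x * g x))) (at x)" .
  qed
qed

lemma polynomial_function_complex_iff:
  fixes f :: "'a::real_normed_vector \<Rightarrow> complex"
  shows "polynomial_function f \<longleftrightarrow>
    real_polynomial_function (\<lambda>x. Re (f x)) \<and> real_polynomial_function (\<lambda>x. Im (f x))"
  unfolding polynomial_function_iff_Basis_inner by (simp add: Basis_complex_def)

lemma polynomial_function_of_real:
  "real_polynomial_function f \<Longrightarrow> polynomial_function (\<lambda>x. complex_of_real (f x))"
  by (simp add: polynomial_function_complex_iff real_polynomial_function.intros(2))

lemma polynomial_function_complex_mult: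
  fixes f g :: "'a::real_normed_vector \<Rightarrow> complex"
  shows "polynomial_function f \<Longrightarrow> polynomial_function g \<Longrightarrow> polynomial_function (\<lambda>x. f x * g x)"
  unfolding polynomial_function_complex_iff
  by (auto intro!: real_polynomial_function.intros(3,4) real_polynomial_function_diff)

lemma real_polynomial_function_coord: "real_polynomial_function (\<lambda>x::real^'d. x $ i)"
  by (intro real_polynomial_function.intros(1) bounded_linear_vec_nth)

lemmas polynomial_function_coord =
  polynomial_function_of_real[OF real_polynomial_function_coord]

lemma partial_deriv_eq:
  assumes "(f has_derivative f') (at x)"
  shows "partial_deriv i f x = f' (axis i 1)"
proof -
  have "((\<lambda>t. f (x + t *\<^sub>R axis i 1)) has_derivative (\<lambda>t. f' (t *\<^sub>R axis i 1))) (at 0)"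
    by (rule has_derivative_compose[of "\<lambda>t. x + t *\<^sub>R axis i 1"])
      (auto intro!: derivative_eq_intros assms)
  moreover have "f' (t *\<^sub>R axis i 1) = t *\<^sub>R f' (axis i 1)" for t
    using assms by (simp add: has_derivative_def bounded_linear.linear linear_cmul)
  ultimately show ?thesis
    unfolding partial_deriv_def
    by (intro vector_derivative_at) (simp add: has_vector_derivative_def)
qed

text \<open>Real and imaginary parts have polynomial gradients, and the line derivatives in
  \<open>partial_deriv\<close> are the coordinates of the total derivative. Closure under partial
  derivatives is what allows second-order operators to be formed without further differentiability
  conditions.\<close>

lemma polynomial_function_partial_deriv:
  fixes f :: "real^'d \<Rightarrow> complex"
  assumes "polynomial_function f"
  shows "polynomial_function (partial_deriv i f)" (is ?P)
    and "(f has_derivative (\<lambda>v. \<Sum>i\<in>UNIV. of_real (v $ i) * partial_deriv i f x)) (at x)" (is ?D)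
proof -
  have re: "real_polynomial_function (\<lambda>x. Re (f x))" and im: "real_polynomial_function (\<lambda>x. Im (f x))"
    using assms by (auto simp: polynomial_function_complex_iff)
  obtain q r where q: "\<And>i. real_polynomial_function (q i)" "\<And>i. real_polynomial_function (r i)"
    "\<And>x. ((\<lambda>x. Re (f x)) has_derivative (\<lambda>v. \<Sum>i\<in>UNIV. v $ i * q i x)) (at x)"
    "\<And>x. ((\<lambda>x. Im (f x)) has_derivative (\<lambda>v. \<Sum>i\<in>UNIV. v $ i * r i x)) (at x)"
    using real_polynomial_function_has_derivative[OF re] real_polynomial_function_has_derivative[OF im]
    by blast
  have D: "(f has_derivative (\<lambda>v. \<Sum>i\<in>UNIV. of_real (v $ i) * Complex (q i x) (r i x))) (at x)" for x
  proof -
    have "((\<lambda>x. of_real (Re (f x)) + \<i> * of_real (Im (f x))) has_derivative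
      (\<lambda>v. of_real (\<Sum>i\<in>UNIV. v $ i * q i x) + \<i> * of_real (\<Sum>i\<in>UNIV. v $ i * r i x))) (at x)"
      by (intro has_derivative_add has_derivative_mult_right has_derivative_of_real q)
    moreover have "of_real (\<Sum>i\<in>UNIV. v $ i * q i x) + \<i> * of_real (\<Sum>i\<in>UNIV. v $ i * r i x)
      = (\<Sum>i\<in>UNIV. of_real (v $ i) * Complex (q i x) (r i x))" for v
      by (simp add: sum_distrib_left sum.distrib Complex_eq algebra_simps)
    ultimately show ?thesis
      by (simp add: complex_eq[symmetric])
  qed
  have pd: "partial_deriv i f x = Complex (q i x) (r i x)" for i x
  proof -
    have "partial_deriv i f x = (\<Sum>j\<in>UNIV. of_real (axis i 1 $ j) * Complex (q j x) (r j x))"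
      by (rule partial_deriv_eq[OF D])
    also have "\<dots> = (\<Sum>j\<in>UNIV. if j = i then Complex (q j x) (r j x) else 0)"
      by (intro sum.cong) (auto simp: axis_def)
    finally show ?thesis
      by simp
  qed
  show ?P
    using q(1,2) by (simp add: polynomial_function_complex_iff pd)
  show ?D
    using D by (simp add: pd)
qed

lemma partial_deriv_diff:
  assumes "polynomial_function f" "polynomial_function g"
  shows "partial_deriv i (\<lambda>x. f x - g x) x = partial_deriv i f x - partial_deriv i g x"
  by (subst partial_deriv_eq[OF has_derivative_diff[OF assms[THEN polynomial_function_partial_deriv(2)]]],
      subst (1 2) assms[THEN polynomial_function_partial_deriv(2), THEN partial_deriv_eq]) simp

lemma partial_deriv_mult:
  assumes "polynomial_function f" "polynomial_function g"
  shows "partial_deriv i (\<lambda>x. f x * g x) x = partial_deriv i f x * g x + f x * partial_deriv i g x"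
  by (subst partial_deriv_eq[OF has_derivative_mult[OF assms[THEN polynomial_function_partial_deriv(2)]]],
      subst (1 2) assms[THEN polynomial_function_partial_deriv(2), THEN partial_deriv_eq]) simp

lemma partial_deriv_sum:
  assumes "finite A" "\<And>a. a \<in> A \<Longrightarrow> polynomial_function (f a)"
  shows "partial_deriv i (\<lambda>x. \<Sum>a\<in>A. f a x) x = (\<Sum>a\<in>A. partial_deriv i (f a) x)"
proof -
  have "((\<lambda>x. \<Sum>a\<in>A. f a x) has_derivative
      (\<lambda>v. \<Sum>a\<in>A. \<Sum>i\<in>UNIV. of_real (v $ i) * partial_deriv i (f a) x)) (at x)"
    using assms by (intro has_derivative_sum polynomial_function_partial_deriv) auto
  from partial_deriv_eq[OF this] show ?thesis
    using assms by (simp add: polynomial_function_partial_deriv(2)[THEN partial_deriv_eq])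
qed

lemma partial_deriv_coord:
  "partial_deriv j (\<lambda>x::real^'d. complex_of_real (x $ i)) x = (if i = j then 1 else 0)"
proof -
  have "((\<lambda>x::real^'d. complex_of_real (x $ i)) has_derivative (\<lambda>v. of_real (v $ i))) (at x)"
    by (intro bounded_linear_imp_has_derivative bounded_linear_compose[OF bounded_linear_of_real]
        bounded_linear_vec_nth)
  from partial_deriv_eq[OF this] show ?thesis
    by (simp add: axis_def)
qed

lemma partial_deriv_cmult:
  assumes "polynomial_function f"
  shows "partial_deriv i (\<lambda>x. c * f x) x = c * partial_deriv i f x"
  using partial_deriv_eq[OF has_derivative_mult_right[OF polynomial_function_partial_deriv(2)[OF assms]]]
    partial_deriv_eq[OF polynomial_function_partial_deriv(2)[OF assms]] by metis

text \<open>Differentiate \<open>f (c *\<^sub>R x)\<close> in \<open>c\<close> at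
  \<open>c = 1\<close> twice over: by the chain rule, and from the power
  \<open>c ^ k\<close>.\<close>

lemma euler_homogeneous:
  assumes "polynomial_function f" "\<And>c x. f (c *\<^sub>R x) = of_real c ^ k * f x"
  shows "(\<Sum>i\<in>UNIV. of_real (x $ i) * partial_deriv i f x) = of_nat k * f x"
proof -
  have "((\<lambda>c. f (c *\<^sub>R x)) has_derivative
      (\<lambda>c. \<Sum>i\<in>UNIV. of_real ((c *\<^sub>R x) $ i) * partial_deriv i f (1 *\<^sub>R x))) (at 1)"
    by (rule has_derivative_compose[of "\<lambda>c. c *\<^sub>R x", OF _ polynomial_function_partial_deriv(2)[OF assms(1)]])
      (auto intro!: derivative_eq_intros)
  then have "((\<lambda>c. f (c *\<^sub>R x)) has_vector_derivative
      (\<Sum>i\<in>UNIV. of_real (x $ i) * partial_deriv i f x)) (at 1)"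
    by (simp add: has_vector_derivative_def sum_distrib_left mult.assoc scaleR_conv_of_real[where ?'a=complex])
  moreover have "((\<lambda>c. of_real c ^ k * f x) has_vector_derivative (of_nat k * f x)) (at 1)"
  proof -
    have "((\<lambda>c. c ^ k * f x) has_field_derivative (of_nat k * f x)) (at (of_real 1))"
      by (auto intro!: derivative_eq_intros)
    from has_vector_derivative_real_field[OF this] show ?thesis by simp
  qed
  ultimately show ?thesis
    unfolding assms(2) by (rule vector_derivative_unique_at)
qed

section \<open>Orthogonality of harmonics of different degrees\<close>

text \<open>For \<open>i \<noteq> j\<close> this is the rotation by the angle \<open>t\<close> in
  the plane of the coordinates \<open>i\<close> and \<open>j\<close>. Writing it as the identity
  plus two axis corrections makes linearity in \<open>x\<close> and the derivative in
  \<open>t\<close> immediate.\<close>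

definition plane_rotation :: "'d \<Rightarrow> 'd \<Rightarrow> real \<Rightarrow> real^'d \<Rightarrow> real^'d" where
  "plane_rotation i j t x = x + ((cos t - 1) * x $ i - sin t * x $ j) *\<^sub>R axis i 1
     + (sin t * x $ i + (cos t - 1) * x $ j) *\<^sub>R axis j 1"

definition angular_deriv :: "'d \<Rightarrow> 'd \<Rightarrow> (real^'d \<Rightarrow> complex) \<Rightarrow> real^'d \<Rightarrow> complex" where
  "angular_deriv i j f x = of_real (x $ i) * partial_deriv j f x - of_real (x $ j) * partial_deriv i f x"

lemma plane_rotation_nth:
  assumes "i \<noteq> j"
  shows "plane_rotation i j t x $ k =
    (if k = i then cos t * x $ i - sin t * x $ j
     else if k = j then sin t * x $ i + cos t * x $ j else x $ k)"
  using assms by (auto simp: plane_rotation_def axis_def algebra_simps)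

lemma plane_rotation_0 [simp]: "plane_rotation i j 0 x = x"
  by (simp add: plane_rotation_def)

lemma plane_rotation_add:
  "i \<noteq> j \<Longrightarrow> plane_rotation i j (s + t) x = plane_rotation i j s (plane_rotation i j t x)"
  by (simp add: vec_eq_iff plane_rotation_nth cos_add sin_add algebra_simps)

lemma linear_plane_rotation: "linear (plane_rotation i j t)"
  by (rule linearI) (simp_all add: plane_rotation_def algebra_simps)

lemma norm_plane_rotation:
  fixes x :: "real^'d"
  assumes "i \<noteq> j"
  shows "norm (plane_rotation i j t x) = norm x"
proof -
  have split: "(\<Sum>k\<in>UNIV. f k) = f i + f j + (\<Sum>k\<in>UNIV - {i, j}. f k)" for f :: "'d \<Rightarrow> real"
    using assms by (subst sum.subset_diff[of "{i, j}"]) auto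
  have "(cos t * x $ i - sin t * x $ j) * (cos t * x $ i - sin t * x $ j)
      + (sin t * x $ i + cos t * x $ j) * (sin t * x $ i + cos t * x $ j)
      = ((cos t)\<^sup>2 + (sin t)\<^sup>2) * (x $ i * x $ i + x $ j * x $ j)"
    by algebra
  then have "plane_rotation i j t x \<bullet> plane_rotation i j t x = x \<bullet> x"
    unfolding inner_vec_def using assms by (simp add: split plane_rotation_nth)
  then show ?thesis
    by (simp add: norm_eq_sqrt_inner)
qed

lemma rotation_matrix_plane_rotation:
  assumes "i \<noteq> j"
  shows "rotation_matrix (matrix (plane_rotation i j t))"
proof -
  have ortho: "orthogonal_matrix (matrix (plane_rotation i j s))" for s
    using norm_plane_rotation[OF assms] linear_plane_rotation
    by (metis orthogonal_transformation orthogonal_transformation_matrix)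
  \<comment> \<open>the determinant is the square of \<open>\<plusminus>1\<close>, so no expansion is needed\<close>
  have "plane_rotation i j t = plane_rotation i j (t / 2) \<circ> plane_rotation i j (t / 2)"
    using plane_rotation_add[OF assms, of "t / 2" "t / 2"] by (simp add: fun_eq_iff)
  then have "det (matrix (plane_rotation i j t)) = (det (matrix (plane_rotation i j (t / 2))))\<^sup>2"
    by (metis matrix_compose linear_plane_rotation det_mul power2_eq_square)
  also have "\<dots> = 1"
    using det_orthogonal_matrix[OF ortho, of "t / 2"] by auto
  finally show ?thesis
    using ortho by (simp add: rotation_matrix_def)
qed

lemma plane_rotation_has_vector_derivative:
  assumes "i \<noteq> j"
  shows "((\<lambda>t. plane_rotation i j t x) has_vector_derivative
    plane_rotation i j t x $ i *\<^sub>R axis j 1 - plane_rotation i j t x $ j *\<^sub>R axis i 1) (at t)"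
proof -
  have "((\<lambda>t. plane_rotation i j t x) has_vector_derivative
    (- sin t * x $ i - cos t * x $ j) *\<^sub>R axis i 1 + (cos t * x $ i - sin t * x $ j) *\<^sub>R axis j 1) (at t)"
    unfolding plane_rotation_def
    by (auto intro!: derivative_eq_intros simp: algebra_simps)
  then show ?thesis
    using assms by (simp add: plane_rotation_nth algebra_simps)
qed

text \<open>The orbit of \<open>x\<close> is the flow of the vector field belonging to
  \<open>angular_deriv\<close>, so the chain rule applies at every \<open>t\<close>. The derivative
  along the whole orbit, not only at \<open>t = 0\<close>, is what bounds the difference quotients
  in \<open>integral_angular_deriv\<close>.\<close>

lemma polynomial_along_plane_rotation:
  fixes f :: "real^'d \<Rightarrow> complex"
  assumes "i \<noteq> j" "polynomial_function f"
  shows "((\<lambda>t. f (plane_rotation i j t x)) has_vector_derivative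
    angular_deriv i j f (plane_rotation i j t x)) (at t)"
proof -
  let ?y = "plane_rotation i j t x"
  let ?D = "\<lambda>v. \<Sum>k\<in>UNIV. of_real (v $ k) * partial_deriv k f ?y"
  have "((\<lambda>t. f (plane_rotation i j t x)) has_vector_derivative
      ?D (?y $ i *\<^sub>R axis j 1 - ?y $ j *\<^sub>R axis i 1)) (at t)"
    using has_derivative_compose[OF plane_rotation_has_vector_derivative[OF assms(1), unfolded has_vector_derivative_def]
        polynomial_function_partial_deriv(2)[OF assms(2)]]
    unfolding has_vector_derivative_def
    by (rule has_derivative_eq_rhs) (simp add: fun_eq_iff sum_distrib_left scaleR_conv_of_real[where ?'a=complex] mult.assoc)
  moreover have "?D (?y $ i *\<^sub>R axis j 1 - ?y $ j *\<^sub>R axis i 1) = angular_deriv i j f ?y"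
  proof -
    have "?D (?y $ i *\<^sub>R axis j 1 - ?y $ j *\<^sub>R axis i 1) =
      (\<Sum>k\<in>UNIV. (if k = j then of_real (?y $ i) * partial_deriv k f ?y else 0)
        - (if k = i then of_real (?y $ j) * partial_deriv k f ?y else 0))"
      by (intro sum.cong) (auto simp: axis_def algebra_simps)
    then show ?thesis
      by (simp add: sum_subtractf angular_deriv_def)
  qed
  ultimately show ?thesis
    by simp
qed

lemma polynomial_function_angular_deriv:
  "polynomial_function f \<Longrightarrow> polynomial_function (angular_deriv i j f)"
  unfolding angular_deriv_def
  by (intro polynomial_function_diff polynomial_function_complex_mult polynomial_function_coord
      polynomial_function_partial_deriv(1))

lemma angular_deriv_mult:
  assumes "polynomial_function f" "polynomial_function g"
  shows "angular_deriv i j (\<lambda>x. f x * g x) x = angular_deriv i j f x * g x + f x * angular_deriv i j g x"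
  unfolding angular_deriv_def by (simp add: partial_deriv_mult[OF assms] algebra_simps)

text \<open>With \<open>E\<close> the Euler operator, the sum of squares is
  \<open>2 (|x|^2 Laplacian - E (E + d - 2))\<close>; the Laplacian kills \<open>f\<close> and
  \<open>E\<close> acts as \<open>k\<close>. The factor 2 arises because each coordinate plane is
  counted as \<open>(i, j)\<close> and as \<open>(j, i)\<close>.\<close>

lemma sum_angular_deriv_square:
  fixes f :: "real^'d \<Rightarrow> complex"
  assumes f: "f \<in> harmonic_space k"
  shows "(\<Sum>i\<in>UNIV. \<Sum>j\<in>UNIV. angular_deriv i j (angular_deriv i j f) x)
    = - 2 * of_nat k * (of_nat k + of_nat CARD('d) - 2) * f x"
proof -
  have p: "polynomial_function f" and h: "\<And>c x. f (c *\<^sub>R x) = of_real c ^ k * f x"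
    and lap: "(\<Sum>i\<in>UNIV. partial_deriv i (partial_deriv i f) x) = 0"
    using f by (auto simp: harmonic_space_def laplacian_def)
  have p': "polynomial_function (partial_deriv i f)" for i
    by (intro polynomial_function_partial_deriv p)
  note euler = euler_homogeneous[OF p h]
  define X where "X = (\<lambda>i. complex_of_real (x $ i))"
  define D where "D = (\<lambda>i. partial_deriv i f x)"
  define H where "H = (\<lambda>i j. partial_deriv i (partial_deriv j f) x)"
  let ?d = "of_nat CARD('d) :: complex" and ?k = "of_nat k :: complex"
  have E1: "(\<Sum>i\<in>UNIV. X i * D i) = ?k * f x"
    using euler[of x] by (simp add: X_def D_def)
  \<comment> \<open>Differentiate the Euler relation in direction \<open>i\<close>, then multiply by
    \<open>X i\<close> and sum over \<open>i\<close>.\<close>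
  have E2: "(\<Sum>i\<in>UNIV. \<Sum>j\<in>UNIV. X i * X j * H i j) = ?k * (?k - 1) * f x"
  proof -
    have "partial_deriv i (\<lambda>x. \<Sum>j\<in>UNIV. of_real (x $ j) * partial_deriv j f x) x = ?k * D i" for i
      using partial_deriv_cmult[OF p, of i ?k x] euler by (simp add: D_def)
    moreover have "partial_deriv i (\<lambda>x. \<Sum>j\<in>UNIV. of_real (x $ j) * partial_deriv j f x) x
      = D i + (\<Sum>j\<in>UNIV. X j * H i j)" for i
    proof -
      have "partial_deriv i (\<lambda>x. \<Sum>j\<in>UNIV. of_real (x $ j) * partial_deriv j f x) x
        = (\<Sum>j\<in>UNIV. (if j = i then D j else 0) + X j * H i j)"
        by (subst partial_deriv_sum)
          (auto intro!: polynomial_function_complex_mult polynomial_function_coord p' sum.cong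
            simp: partial_deriv_mult[OF polynomial_function_coord p'] partial_deriv_coord X_def D_def H_def)
      then show ?thesis
        by (simp add: sum.distrib)
    qed
    ultimately have *: "(\<Sum>j\<in>UNIV. X j * H i j) = (?k - 1) * D i" for i
      by (simp add: algebra_simps eq_diff_eq)
    have "(\<Sum>i\<in>UNIV. \<Sum>j\<in>UNIV. X i * X j * H i j) = (\<Sum>i\<in>UNIV. X i * (\<Sum>j\<in>UNIV. X j * H i j))"
      by (simp add: sum_distrib_left mult.assoc)
    also have "\<dots> = (?k - 1) * (\<Sum>i\<in>UNIV. X i * D i)"
      by (simp add: * sum_distrib_left mult_ac)
    finally show ?thesis
      by (simp add: E1)
  qed
  have pd: "partial_deriv a (angular_deriv i j f) x
      = (if i = a then D j else 0) + X i * H a j - ((if j = a then D i else 0) + X j * H a i)" for a i j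
    unfolding angular_deriv_def
    by (subst partial_deriv_diff)
      (auto intro!: polynomial_function_complex_mult polynomial_function_coord p'
        simp: partial_deriv_mult[OF polynomial_function_coord p'] partial_deriv_coord X_def D_def H_def)
  \<comment> \<open>On the diagonal \<open>i = j\<close> the left side is zero; the last summand is
    there to cancel the two first-order terms in that case.\<close>
  have square: "angular_deriv i j (angular_deriv i j f) x =
      (X i * X i * H j j + X j * X j * H i i - X i * X j * H j i - X j * X i * H i j)
      - X i * D i - X j * D j + 2 * (if i = j then X i * D j else 0)" for i j
  proof -
    have "angular_deriv i j (angular_deriv i j f) x =
        X i * partial_deriv j (angular_deriv i j f) x - X j * partial_deriv i (angular_deriv i j f) x"
      by (simp only: angular_deriv_def[of i j "angular_deriv i j f" x] X_def)
    then show ?thesis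
      unfolding pd by (cases "i = j") (auto simp: algebra_simps)
  qed
  have sq: "(\<Sum>i\<in>UNIV. \<Sum>j\<in>UNIV. X i * X i * H j j) = 0"
  proof -
    have "(\<Sum>j\<in>UNIV. H j j) = 0"
      using lap unfolding H_def .
    then show ?thesis
      unfolding sum_distrib_left[symmetric] by simp
  qed
  have sq': "(\<Sum>i\<in>UNIV. \<Sum>j\<in>UNIV. X j * X j * H i i) = 0"
    using sq by (subst sum.swap) simp
  have E2': "(\<Sum>i\<in>UNIV. \<Sum>j\<in>UNIV. X i * X j * H j i) = ?k * (?k - 1) * f x"
    using E2 by (subst sum.swap) (simp add: mult_ac)
  have E2'': "(\<Sum>i\<in>UNIV. \<Sum>j\<in>UNIV. X j * X i * H i j) = ?k * (?k - 1) * f x"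
    using E2 by (simp add: mult_ac)
  have "(\<Sum>i\<in>UNIV. \<Sum>j\<in>UNIV. angular_deriv i j (angular_deriv i j f) x)
    = - 2 * (?k * (?k - 1) * f x) - 2 * ?d * (?k * f x) + 2 * (?k * f x)"
  proof -
    have "(\<Sum>i\<in>UNIV. \<Sum>j\<in>(UNIV::'d set). X i * D i) = ?d * (?k * f x)"
      using E1 by (simp add: sum_distrib_left[symmetric])
    moreover have "(\<Sum>i\<in>(UNIV::'d set). \<Sum>j\<in>UNIV. X j * D j) = ?d * (?k * f x)"
      using E1 by simp
    moreover have "(\<Sum>i\<in>UNIV. \<Sum>j\<in>UNIV. 2 * (if i = j then X i * D j else 0)) = 2 * (?k * f x)"
      using E1 by (simp add: sum_distrib_left[symmetric])
    ultimately show ?thesis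
      unfolding square sum.distrib sum_subtractf sq sq' E2' E2'' by (simp add: algebra_simps)
  qed
  then show ?thesis
    by (simp add: algebra_simps)
qed

section \<open>Integration against a rotation invariant measure on the sphere\<close>

locale sphere_measure =
  fixes M :: "(real^'d) measure"
  assumes invariant: "rotation_invariant M"
begin

lemma sets_M: "sets M = sets (restrict_space borel (sphere 0 1))"
  using invariant by (simp add: rotation_invariant_def)

lemma space_M: "space M = sphere 0 1"
  using sets_eq_imp_space_eq[OF sets_M] by (simp add: space_restrict_space)

sublocale finite_measure M
  using invariant by (simp add: rotation_invariant_def)

lemma measurable_M:
  fixes f :: "real^'d \<Rightarrow> 'b::topological_space"
  assumes "continuous_on (sphere 0 1) f"
  shows "f \<in> borel_measurable M"
  using borel_measurable_continuous_on_restrict[OF assms] measurable_cong_sets[OF sets_M refl] by blast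

lemma integrable_M:
  fixes f :: "real^'d \<Rightarrow> 'b::{banach, second_countable_topology}"
  assumes "continuous_on (sphere 0 1) f"
  shows "integrable M f"
proof -
  have "bounded (f ` sphere 0 1)"
    by (intro compact_imp_bounded compact_continuous_image assms compact_sphere)
  then obtain B where "\<And>x. x \<in> sphere 0 1 \<Longrightarrow> norm (f x) \<le> B"
    unfolding bounded_iff by blast
  then show ?thesis
    by (intro integrable_const_bound[of f B] measurable_M assms AE_I2) (simp add: space_M)
qed

lemma integrable_polynomial:
  "polynomial_function (f :: real^'d \<Rightarrow> complex) \<Longrightarrow> integrable M f"
  by (intro integrable_M continuous_on_polymonial_function)

lemma integral_rotation:
  fixes f :: "real^'d \<Rightarrow> 'b::{banach, second_countable_topology}"
  assumes "rotation_matrix Q" "continuous_on (sphere 0 1) f"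
  shows "(\<integral>x. f (Q *v x) \<partial>M) = (\<integral>x. f x \<partial>M)"
proof -
  have Q: "norm (Q *v x) = norm x" for x
    using assms(1) orthogonal_transformation_matrix[of "\<lambda>x. Q *v x"]
    by (auto simp: rotation_matrix_def orthogonal_transformation)
  have "(\<lambda>x. Q *v x) \<in> measurable (restrict_space borel (sphere 0 1)) (restrict_space borel (sphere 0 1))"
    by (intro measurable_restrict_space3 borel_measurable_continuous_onI)
      (auto simp: Q intro!: linear_continuous_on linear_linear[THEN iffD2])
  then have meas: "(\<lambda>x. Q *v x) \<in> measurable M M"
    using measurable_cong_sets[OF sets_M sets_M] by blast
  have "(\<integral>x. f x \<partial>M) = (\<integral>x. f x \<partial>distr M M (\<lambda>x. Q *v x))"
    using invariant assms(1) by (simp add: rotation_invariant_def)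
  also have "\<dots> = (\<integral>x. f (Q *v x) \<partial>M)"
    by (intro integral_distr meas measurable_M assms)
  finally show ?thesis
    by simp
qed

text \<open>Rotation does not change the integral of \<open>f\<close>, so every difference quotient
  \<open>s n\<close> has integral zero. Orbits stay on the sphere, hence the mean value inequality
  bounds the quotients by the maximum \<open>B\<close> of the derivative there, and dominated
  convergence along the angles \<open>h n\<close> passes to the limit.\<close>

lemma integral_angular_deriv:
  fixes f :: "real^'d \<Rightarrow> complex"
  assumes f: "polynomial_function f"
  shows "(\<integral>x. angular_deriv i j f x \<partial>M) = 0"
proof (cases "i = j")
  case True
  then show ?thesis by (simp add: angular_deriv_def)
next
  case False
  define h where "h = (\<lambda>n. 1 / real (Suc n))"
  define s where "s = (\<lambda>n x. (f (plane_rotation i j (h n) x) - f x) /\<^sub>R h n)"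
  have h_pos: "h n > 0" for n by (simp add: h_def)
  have cont: "continuous_on S f" for S
    by (intro continuous_on_polymonial_function f)
  have rot_cont: "continuous_on S (plane_rotation i j t)" for S t
    by (intro linear_continuous_on linear_linear[THEN iffD2] linear_plane_rotation)
  have frot_cont: "continuous_on S (\<lambda>x. f (plane_rotation i j t x))" for S t
    by (rule continuous_on_compose2[OF cont[of UNIV] rot_cont]) auto
  have ang_cont: "continuous_on S (angular_deriv i j f)" for S
    by (intro continuous_on_polymonial_function polynomial_function_angular_deriv f)
  have "bounded (angular_deriv i j f ` sphere 0 1)"
    by (intro compact_imp_bounded compact_continuous_image ang_cont compact_sphere)
  then obtain B where B: "\<And>x. x \<in> sphere 0 1 \<Longrightarrow> norm (angular_deriv i j f x) \<le> B"
    unfolding bounded_iff by blast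
  have "(\<lambda>n. \<integral>x. s n x \<partial>M) \<longlonglongrightarrow> (\<integral>x. angular_deriv i j f x \<partial>M)"
  proof (rule integral_dominated_convergence[where w = "\<lambda>x. B"])
    show "angular_deriv i j f \<in> borel_measurable M"
      by (intro measurable_M ang_cont)
    show "s n \<in> borel_measurable M" for n
      unfolding s_def by (intro measurable_M continuous_intros frot_cont cont)
    show "integrable M (\<lambda>x. B)" by simp
    show "AE x in M. (\<lambda>n. s n x) \<longlonglongrightarrow> angular_deriv i j f x"
    proof (rule AE_I2)
      fix x
      have "(\<lambda>t. norm (f (plane_rotation i j (0 + t) x) - f (plane_rotation i j 0 x)
          - t *\<^sub>R angular_deriv i j f x) / norm t) \<midarrow>0\<rightarrow> 0"
        using polynomial_along_plane_rotation[OF False f, of x 0]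
        by (simp add: has_vector_derivative_def has_derivative_at)
      then have "(\<lambda>t. norm ((f (plane_rotation i j t x) - f x) /\<^sub>R t - angular_deriv i j f x)) \<midarrow>0\<rightarrow> 0"
      proof (rule Lim_transform_eventually)
        have "norm (u - t *\<^sub>R v) / norm t = norm (u /\<^sub>R t - v)" if "t \<noteq> 0" for t :: real and u v :: complex
        proof -
          have "u /\<^sub>R t - v = (u - t *\<^sub>R v) /\<^sub>R t"
            using that by (simp add: scaleR_diff_right)
          then show ?thesis
            by (simp add: divide_inverse mult.commute)
        qed
        then show "\<forall>\<^sub>F t in at 0. norm (f (plane_rotation i j (0 + t) x) - f (plane_rotation i j 0 x)
            - t *\<^sub>R angular_deriv i j f x) / norm t
            = norm ((f (plane_rotation i j t x) - f x) /\<^sub>R t - angular_deriv i j f x)"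
          by (auto simp: eventually_at_filter)
      qed
      then have "((\<lambda>t. (f (plane_rotation i j t x) - f x) /\<^sub>R t) \<longlongrightarrow> angular_deriv i j f x) (at 0)"
        by (simp add: Lim_null[of _ "angular_deriv i j f x"] tendsto_norm_zero_iff)
      moreover have "filterlim h (at 0) sequentially"
        unfolding filterlim_at using h_pos LIMSEQ_inverse_real_of_nat
        by (auto simp: h_def less_imp_neq[THEN not_sym] inverse_eq_divide)
      ultimately show "(\<lambda>n. s n x) \<longlonglongrightarrow> angular_deriv i j f x"
        unfolding s_def by (auto dest: filterlim_compose)
    qed
    show "AE x in M. norm (s n x) \<le> B" for n
    proof (rule AE_I2)
      fix x assume x: "x \<in> space M"
      have "norm (f (plane_rotation i j (h n) x) - f (plane_rotation i j 0 x)) \<le> B * norm (h n - 0)"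
      proof (rule differentiable_bound[of UNIV _ "\<lambda>t h. h *\<^sub>R angular_deriv i j f (plane_rotation i j t x)"])
        fix t
        show "((\<lambda>t. f (plane_rotation i j t x)) has_derivative
            (\<lambda>h. h *\<^sub>R angular_deriv i j f (plane_rotation i j t x))) (at t within UNIV)"
          using polynomial_along_plane_rotation[OF False f] by (simp add: has_vector_derivative_def)
        have "norm (angular_deriv i j f (plane_rotation i j t x)) \<le> B"
          using x False by (intro B) (simp add: space_M norm_plane_rotation)
        then show "onorm (\<lambda>h. h *\<^sub>R angular_deriv i j f (plane_rotation i j t x)) \<le> B"
          by (intro onorm_le) (simp add: mult.commute[of B] mult_left_mono)
      qed auto
      then show "norm (s n x) \<le> B"
        using h_pos[of n] by (simp add: s_def mult.commute[of "inverse _"] divide_inverse[symmetric] pos_divide_le_eq)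
    qed
  qed
  moreover have "(\<integral>x. s n x \<partial>M) = 0" for n
  proof -
    have "(\<integral>x. f (plane_rotation i j (h n) x) \<partial>M) = (\<integral>x. f x \<partial>M)"
      using integral_rotation[OF rotation_matrix_plane_rotation[OF False] cont, of "h n"]
      by (simp add: matrix_works linear_plane_rotation)
    then show ?thesis
      unfolding s_def by (simp add: integrable_M frot_cont cont)
  qed
  ultimately show ?thesis
    using LIMSEQ_unique[of "\<lambda>n. 0"] by auto
qed

lemma integral_angular_deriv_by_parts:
  fixes f g :: "real^'d \<Rightarrow> complex"
  assumes f: "polynomial_function f" and g: "polynomial_function g"
  shows "(\<integral>x. angular_deriv i j f x * g x \<partial>M) = - (\<integral>x. f x * angular_deriv i j g x \<partial>M)"
proof -
  have "0 = (\<integral>x. angular_deriv i j (\<lambda>x. f x * g x) x \<partial>M)"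
    by (intro integral_angular_deriv[symmetric] polynomial_function_complex_mult f g)
  also have "\<dots> = (\<integral>x. angular_deriv i j f x * g x + f x * angular_deriv i j g x \<partial>M)"
    by (simp add: angular_deriv_mult[OF f g])
  also have "\<dots> = (\<integral>x. angular_deriv i j f x * g x \<partial>M) + (\<integral>x. f x * angular_deriv i j g x \<partial>M)"
    by (intro Bochner_Integration.integral_add integrable_polynomial polynomial_function_complex_mult
        polynomial_function_angular_deriv f g)
  finally show ?thesis
    by (simp add: eq_neg_iff_add_eq_0)
qed

text \<open>The pairing carries no conjugate. Integrating by parts twice moves each squared rotation
  field from \<open>f\<close> to \<open>g\<close> with sign plus, so the two eigenvalues give
  \<open>(e k - e m) * I = 0\<close>.\<close>

lemma harmonic_spaces_orthogonal:
  fixes f g :: "real^'d \<Rightarrow> complex"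
  assumes d: "CARD('d) \<ge> 2" and f: "f \<in> harmonic_space k" and g: "g \<in> harmonic_space m"
    and "k \<noteq> m"
  shows "(\<integral>x. f x * g x \<partial>M) = 0"
proof -
  have pf: "polynomial_function f" and pg: "polynomial_function g"
    using f g by (auto simp: harmonic_space_def)
  define I where "I = (\<integral>x. f x * g x \<partial>M)"
  define e where "e = (\<lambda>k. - 2 * of_nat k * (of_nat k + of_nat CARD('d) - 2) :: complex)"
  have "e k * I = (\<integral>x. (\<Sum>i\<in>UNIV. \<Sum>j\<in>UNIV. angular_deriv i j (angular_deriv i j f) x) * g x \<partial>M)"
    by (simp add: sum_angular_deriv_square[OF f] I_def e_def mult.assoc)
  also have "\<dots> = (\<Sum>i\<in>UNIV. \<Sum>j\<in>UNIV. \<integral>x. angular_deriv i j (angular_deriv i j f) x * g x \<partial>M)"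
    unfolding sum_distrib_right
    by (subst Bochner_Integration.integral_sum, intro Bochner_Integration.integrable_sum
        integrable_polynomial polynomial_function_complex_mult polynomial_function_angular_deriv pf pg,
        intro sum.cong refl Bochner_Integration.integral_sum integrable_polynomial
        polynomial_function_complex_mult polynomial_function_angular_deriv pf pg)
  also have "\<dots> = (\<Sum>i\<in>UNIV. \<Sum>j\<in>UNIV. \<integral>x. f x * angular_deriv i j (angular_deriv i j g) x \<partial>M)"
    by (simp add: integral_angular_deriv_by_parts pf pg polynomial_function_angular_deriv)
  also have "\<dots> = (\<integral>x. f x * (\<Sum>i\<in>UNIV. \<Sum>j\<in>UNIV. angular_deriv i j (angular_deriv i j g) x) \<partial>M)"
    unfolding sum_distrib_left
    by (subst Bochner_Integration.integral_sum, intro Bochner_Integration.integrable_sum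
        integrable_polynomial polynomial_function_complex_mult polynomial_function_angular_deriv pf pg,
        intro sum.cong refl Bochner_Integration.integral_sum[symmetric] integrable_polynomial
        polynomial_function_complex_mult polynomial_function_angular_deriv pf pg)
  also have "\<dots> = (\<integral>x. e m * (f x * g x) \<partial>M)"
    by (simp add: sum_angular_deriv_square[OF g] e_def mult_ac)
  also have "\<dots> = e m * I"
    by (simp add: I_def)
  finally have "(e k - e m) * I = 0"
    by (simp add: algebra_simps)
  \<comment> \<open>The difference of \<open>k (k + d - 2)\<close> and \<open>m (m + d - 2)\<close>
    factors as \<open>(k - m) (k + m + d - 2)\<close>. Distinct \<open>k\<close> and
    \<open>m\<close> have \<open>k + m \<ge> 1\<close>, so \<open>d \<ge> 2\<close> makes the second
    factor positive.\<close>
  moreover have "e k - e m \<noteq> 0"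
  proof -
    have "e k - e m = - 2 * of_int ((int k - int m) * (int k + int m + int CARD('d) - 2))"
      by (simp add: e_def algebra_simps)
    moreover have "(int k - int m) * (int k + int m + int CARD('d) - 2) \<noteq> 0"
      using d \<open>k \<noteq> m\<close> by auto
    ultimately show ?thesis
      by (simp del: of_int_mult of_int_diff of_int_add)
  qed
  ultimately show ?thesis
    by (simp add: I_def)
qed

end

section \<open>Gegenbauer polynomials and the expansion coefficients of the Poisson kernel\<close>

text \<open>The formal power \<open>(1 - 2 s X + q X^2)^(-a)\<close>; at \<open>q = 1\<close> its
  coefficients are the Gegenbauer polynomials in \<open>s\<close>. The extra variable
  \<open>q\<close>, later \<open>x \<bullet> x\<close>, makes the coefficients homogeneous in
  \<open>x\<close>.\<close>

definition gegenbauer :: "'a::field_char_0 \<Rightarrow> 'a \<Rightarrow> 'a \<Rightarrow> 'a fps" where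
  "gegenbauer a s q = fps_compose (fps_binomial (- a))
     (fps_const (- 2 * s) * fps_X + fps_const q * fps_X ^ 2)"

text \<open>This is \<open>(1 + v)^(-a) = (1 + v)^(-a-1) (1 + v)\<close>, composed with
  \<open>v = -2 s X + q X^2\<close>.\<close>

lemma gegenbauer_mult:
  "(1 - fps_const (2 * s) * fps_X + fps_const q * fps_X ^ 2) * gegenbauer (a + 1) s q = gegenbauer a s q"
proof -
  let ?v = "fps_const (- 2 * s) * fps_X + fps_const q * fps_X ^ 2"
  have "fps_binomial (- a) = fps_binomial (- (a + 1)) * (1 + fps_X)"
    using fps_binomial_add_mult[of "- (a + 1)" 1] by (simp add: fps_binomial_1)
  then have "gegenbauer a s q = gegenbauer (a + 1) s q * (1 + ?v)"
    by (simp add: gegenbauer_def fps_compose_mult_distrib fps_compose_add_distrib)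
  then show ?thesis
    by (simp add: mult.commute algebra_simps flip: fps_const_neg)
qed

lemma fps_deriv_gegenbauer:
  "fps_deriv (gegenbauer a s q)
    = fps_const (2 * a) * (fps_const s - fps_const q * fps_X) * gegenbauer (a + 1) s q"
proof -
  let ?v = "fps_const (- 2 * s) * fps_X + fps_const q * fps_X ^ 2"
  have "fps_binomial (- a) = fps_binomial (- (a + 1)) * (1 + fps_X)"
    using fps_binomial_add_mult[of "- (a + 1)" 1] by (simp add: fps_binomial_1)
  then have "fps_deriv (fps_binomial (- a)) = fps_const (- a) * fps_binomial (- (a + 1))"
    unfolding fps_binomial_deriv by (simp only: mult.assoc[symmetric]) simp
  then have "fps_deriv (gegenbauer a s q) = fps_const (- a) * gegenbauer (a + 1) s q * fps_deriv ?v"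
    unfolding gegenbauer_def
    by (subst fps_compose_deriv) (simp_all add: fps_compose_mult_distrib)
  also have "fps_deriv ?v = - fps_const 2 * (fps_const s - fps_const q * fps_X)"
    by (simp add: power2_eq_square algebra_simps flip: fps_const_mult fps_const_neg numeral_fps_const)
  finally show ?thesis
    by (simp add: algebra_simps flip: fps_const_mult fps_const_neg numeral_fps_const)
qed

lemma gegenbauer_nth_0 [simp]: "fps_nth (gegenbauer a s q) 0 = 1"
  by (simp add: gegenbauer_def)

lemma gegenbauer_nth_1: "fps_nth (gegenbauer a s q) (Suc 0) = 2 * a * s"
proof -
  have "fps_nth (gegenbauer a s q) (Suc 0) = fps_nth (fps_deriv (gegenbauer a s q)) 0"
    by simp
  then show ?thesis
    unfolding fps_deriv_gegenbauer by simp
qed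

text \<open>Coefficients are compared in \<open>fps_deriv_gegenbauer\<close>. The recursion lowers
  the degree but raises the parameter, which is why the inductions based on it generalise over
  \<open>a\<close>.\<close>

lemma gegenbauer_nth_Suc_Suc:
  "fps_nth (gegenbauer a s q) (Suc (Suc n)) = 2 * a / of_nat (Suc (Suc n)) *
     (s * fps_nth (gegenbauer (a + 1) s q) (Suc n) - q * fps_nth (gegenbauer (a + 1) s q) n)"
proof -
  have "of_nat (Suc (Suc n)) * fps_nth (gegenbauer a s q) (Suc (Suc n))
      = fps_nth (fps_deriv (gegenbauer a s q)) (Suc n)"
    by simp
  also have "\<dots> = 2 * a * (s * fps_nth (gegenbauer (a + 1) s q) (Suc n)
       - q * fps_nth (gegenbauer (a + 1) s q) n)"
    unfolding fps_deriv_gegenbauer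
    by (simp add: mult.assoc left_diff_distrib right_diff_distrib)
  finally show ?thesis
    by (simp add: field_simps del: of_nat_Suc)
qed

lemma gegenbauer_nth_scale:
  "fps_nth (gegenbauer a (c * s) (c\<^sup>2 * q)) n = c ^ n * fps_nth (gegenbauer a s q) n"
proof (induction n arbitrary: a rule: induct_nat_012)
  case (ge2 n)
  show ?case
    unfolding gegenbauer_nth_Suc_Suc ge2 by (simp add: power2_eq_square algebra_simps)
qed (simp_all add: gegenbauer_nth_1)

lemma gegenbauer_nth_of_real:
  "fps_nth (gegenbauer (of_real a :: 'a::real_field) (of_real s) (of_real q)) n
    = of_real (fps_nth (gegenbauer a s q) n)"
proof (induction n arbitrary: a rule: induct_nat_012)
  case (ge2 n)
  have a: "of_real a + 1 = (of_real (a + 1) :: 'a)" for a by simp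
  show ?case
    unfolding gegenbauer_nth_Suc_Suc a ge2 by simp
qed (simp_all add: gegenbauer_nth_1)

lemma gegenbauer_nth_polynomial:
  fixes \<theta> :: "real^'d"
  shows "real_polynomial_function (\<lambda>x. fps_nth (gegenbauer a (x \<bullet> \<theta>) (x \<bullet> x)) n)"
proof -
  have 1: "real_polynomial_function (\<lambda>x. x \<bullet> \<theta>)"
    by (intro real_polynomial_function.intros(1) bounded_linear_inner_left)
  have 2: "real_polynomial_function (\<lambda>x::real^'d. x \<bullet> x)"
    unfolding inner_vec_def
    by (intro real_polynomial_function_sum) (auto intro: real_polynomial_function.intros(4) real_polynomial_function_coord)
  show ?thesis
  proof (induction n arbitrary: a rule: induct_nat_012)
    case (ge2 n)
    show ?case
      unfolding gegenbauer_nth_Suc_Suc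
      by (intro real_polynomial_function.intros(2,4) real_polynomial_function_diff 1 2 ge2)
  next
    case 1
    show ?case
      unfolding gegenbauer_nth_1 One_nat_def
      by (intro real_polynomial_function.intros(2,4) \<open>real_polynomial_function (\<lambda>x. x \<bullet> \<theta>)\<close>)
  qed (simp add: real_polynomial_function.intros(2))
qed

section \<open>Coefficientwise derivatives of formal power series with respect to a real
  parameter\<close>

definition fps_has_deriv :: "(real \<Rightarrow> real fps) \<Rightarrow> real fps \<Rightarrow> real \<Rightarrow> bool" where
  "fps_has_deriv F F' t \<longleftrightarrow>
    (\<forall>n. ((\<lambda>t. fps_nth (F t) n) has_real_derivative fps_nth F' n) (at t))"

lemma fps_has_deriv_add:
  "fps_has_deriv F F' t \<Longrightarrow> fps_has_deriv G G' t \<Longrightarrow> fps_has_deriv (\<lambda>t. F t + G t) (F' + G') t"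
  by (auto simp: fps_has_deriv_def intro!: derivative_eq_intros)

lemma fps_has_deriv_diff:
  "fps_has_deriv F F' t \<Longrightarrow> fps_has_deriv G G' t \<Longrightarrow> fps_has_deriv (\<lambda>t. F t - G t) (F' - G') t"
  by (auto simp: fps_has_deriv_def intro!: derivative_eq_intros)

lemma fps_has_deriv_mult:
  assumes "fps_has_deriv F F' t" "fps_has_deriv G G' t"
  shows "fps_has_deriv (\<lambda>t. F t * G t) (F t * G' + F' * G t) t"
  unfolding fps_has_deriv_def
proof
  fix n
  have "((\<lambda>t. \<Sum>i=0..n. fps_nth (F t) i * fps_nth (G t) (n - i)) has_real_derivative
      (\<Sum>i=0..n. fps_nth (F t) i * fps_nth G' (n - i) + fps_nth F' i * fps_nth (G t) (n - i))) (at t)"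
    using assms unfolding fps_has_deriv_def by (intro DERIV_sum DERIV_mult') auto
  then show "((\<lambda>t. fps_nth (F t * G t) n) has_real_derivative fps_nth (F t * G' + F' * G t) n) (at t)"
    by (simp add: fps_mult_nth sum.distrib)
qed

lemma fps_has_deriv_const: "fps_has_deriv (\<lambda>t. F) 0 t"
  by (simp add: fps_has_deriv_def)

lemma fps_has_deriv_fps_const:
  "(f has_real_derivative f') (at t) \<Longrightarrow> fps_has_deriv (\<lambda>t. fps_const (f t)) (fps_const f') t"
  by (auto simp: fps_has_deriv_def)

lemma fps_has_deriv_cong:
  "fps_has_deriv F F' t \<Longrightarrow> F' = G' \<Longrightarrow> fps_has_deriv F G' t"
  by simp

text \<open>Formally the chain rule for \<open>(1 - 2 s X + q X^2)^(-a)\<close>. The derivative of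
  \<open>q\<close> is named \<open>2 * q'\<close> so that the common factor \<open>2 * a\<close>
  comes out; in the application \<open>q = x \<bullet> x\<close> and
  \<open>q' = x $ i\<close>.\<close>

lemma fps_has_deriv_gegenbauer:
  assumes s: "(s has_real_derivative s') (at t)" and q: "(q has_real_derivative 2 * q') (at t)"
  shows "fps_has_deriv (\<lambda>t. gegenbauer a (s t) (q t))
    (fps_const (2 * a) * (fps_const s' * fps_X - fps_const q' * fps_X ^ 2) * gegenbauer (a + 1) (s t) (q t)) t"
proof -
  define E where "E = (\<lambda>a. fps_const (2 * a) * (fps_const s' * fps_X - fps_const q' * fps_X ^ 2)
    * gegenbauer (a + 1) (s t) (q t))"
  \<comment> \<open>differentiation in \<open>t\<close> commutes with differentiation in \<open>X\<close>, which raises \<open>a\<close> and lowers the degree\<close>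
  have E_deriv: "fps_deriv (E a) = fps_const (2 * a) * ((fps_const s' - fps_const (2 * q') * fps_X)
      * gegenbauer (a + 1) (s t) (q t) + (fps_const (s t) - fps_const (q t) * fps_X) * E (a + 1))" for a
    unfolding E_def
    by (simp add: fps_deriv_gegenbauer power2_eq_square algebra_simps flip: fps_const_mult numeral_fps_const)
  have "((\<lambda>t. fps_nth (gegenbauer a (s t) (q t)) n) has_real_derivative fps_nth (E a) n) (at t)" for n
  proof (induction n arbitrary: a rule: less_induct)
    case (less n)
    show ?case
    proof (cases n)
      case 0
      then show ?thesis by (simp add: E_def mult.assoc)
    next
      case (Suc m)
      have 1: "((\<lambda>t. fps_nth (gegenbauer (a + 1) (s t) (q t)) m) has_real_derivative fps_nth (E (a + 1)) m) (at t)"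
        using less Suc by simp
      \<comment> \<open>Multiplication by \<open>fps_X\<close> shifts the index and yields
        coefficient 0 at \<open>m = 0\<close>, so degree one and the higher degrees share a single
        recursion.\<close>
      have 2: "((\<lambda>t. fps_nth (fps_X * gegenbauer (a + 1) (s t) (q t)) m) has_real_derivative
          fps_nth (fps_X * E (a + 1)) m) (at t)"
        using less Suc by (cases m) simp_all
      note DERIV_cdivide[OF DERIV_cmult[OF DERIV_diff[OF DERIV_mult'[OF s 1] DERIV_mult'[OF q 2]], of "2 * a"],
          of "of_nat n"]
      moreover have "2 * a * (s t * fps_nth (E (a + 1)) m + s' * fps_nth (gegenbauer (a + 1) (s t) (q t)) m
          - (q t * fps_nth (fps_X * E (a + 1)) m + 2 * q' * fps_nth (fps_X * gegenbauer (a + 1) (s t) (q t)) m))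
          = fps_nth (fps_deriv (E a)) m"
      proof -
        have "fps_deriv (E a) = fps_const (2 * a) * (fps_const s' * gegenbauer (a + 1) (s t) (q t)
            - fps_const (2 * q') * (fps_X * gegenbauer (a + 1) (s t) (q t))
            + (fps_const (s t) * E (a + 1) - fps_const (q t) * (fps_X * E (a + 1))))"
          unfolding E_deriv by (simp add: algebra_simps)
        then show ?thesis
          by (simp del: fps_X_mult_nth)
      qed
      moreover have "fps_nth (gegenbauer a (s t) (q t)) n =
          2 * a * (s t * fps_nth (gegenbauer (a + 1) (s t) (q t)) m
            - q t * fps_nth (fps_X * gegenbauer (a + 1) (s t) (q t)) m) / of_nat n" for t
        using Suc by (cases m) (simp_all add: gegenbauer_nth_1 gegenbauer_nth_Suc_Suc)
      moreover have "fps_nth (fps_deriv (E a)) m / of_nat n = fps_nth (E a) n"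
        using Suc by simp
      ultimately show ?thesis
        by (simp only:)
    qed
  qed
  then show ?thesis
    by (simp add: fps_has_deriv_def E_def)
qed


section \<open>The homogenised Poisson kernel and its harmonic coefficients\<close>

text \<open>For a unit vector \<open>\<theta>\<close> this is the expansion in \<open>r\<close> of
  \<open>(1 - |r x|^2) / |\<theta> - r x|^d\<close> at an arbitrary point \<open>x\<close>. Keeping
  \<open>x \<bullet> x\<close> in place of 1 is what gives homogeneous harmonic coefficients on the
  whole space.\<close>

definition poisson_fps :: "real^'d \<Rightarrow> real^'d \<Rightarrow> real fps" where
  "poisson_fps \<theta> x = (1 - fps_const (x \<bullet> x) * fps_X ^ 2) * gegenbauer (CARD('d) / 2) (x \<bullet> \<theta>) (x \<bullet> x)"

definition poisson_fps_partial :: "real^'d \<Rightarrow> 'd \<Rightarrow> real^'d \<Rightarrow> real fps" where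
  "poisson_fps_partial \<theta> i x =
    - fps_const (2 * x $ i) * fps_X ^ 2 * gegenbauer (CARD('d) / 2) (x \<bullet> \<theta>) (x \<bullet> x)
    + (1 - fps_const (x \<bullet> x) * fps_X ^ 2) * (fps_const (real CARD('d))
      * (fps_const (\<theta> $ i) * fps_X - fps_const (x $ i) * fps_X ^ 2)
      * gegenbauer (CARD('d) / 2 + 1) (x \<bullet> \<theta>) (x \<bullet> x))"

text \<open>The pure second derivative in direction \<open>i\<close>. Here \<open>u\<close> is minus
  one half of the derivative of the base \<open>1 - 2 (x \<bullet> \<theta>) X + |x|^2 X^2\<close>;
  it is left unexpanded because the sums over \<open>i\<close> of \<open>y * u\<close> and
  \<open>u ^ 2\<close> have short closed forms.\<close>

definition poisson_fps_partial2 :: "real^'d \<Rightarrow> 'd \<Rightarrow> real^'d \<Rightarrow> real fps" where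
  "poisson_fps_partial2 \<theta> i x =
    (let d = fps_const (real CARD('d)); u = fps_const (\<theta> $ i) * fps_X - fps_const (x $ i) * fps_X ^ 2;
         y = fps_const (x $ i); F = (\<lambda>a. gegenbauer a (x \<bullet> \<theta>) (x \<bullet> x))
     in - 2 * fps_X ^ 2 * F (CARD('d) / 2) - 4 * d * fps_X ^ 2 * (y * u) * F (CARD('d) / 2 + 1)
       - d * (1 - fps_const (x \<bullet> x) * fps_X ^ 2) * fps_X ^ 2 * F (CARD('d) / 2 + 1)
       + d * (d + 2) * (1 - fps_const (x \<bullet> x) * fps_X ^ 2) * u ^ 2 * F (CARD('d) / 2 + 2))"

lemma has_real_derivative_inner_line:
  fixes x \<theta> :: "real^'d"
  shows "((\<lambda>t. (x + t *\<^sub>R axis i 1) \<bullet> \<theta>) has_real_derivative \<theta> $ i) (at t)"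
    and "((\<lambda>t. (x + t *\<^sub>R axis i 1) \<bullet> (x + t *\<^sub>R axis i 1)) has_real_derivative
      2 * ((x + t *\<^sub>R axis i 1) $ i)) (at t)"
    and "((\<lambda>t. (x + t *\<^sub>R axis i 1) $ i) has_real_derivative 1) (at t)"
  by (auto simp: inner_add_left inner_add_right inner_axis inner_axis' algebra_simps
      intro!: derivative_eq_intros)

lemma poisson_fps_has_deriv:
  fixes x \<theta> :: "real^'d"
  shows "fps_has_deriv (\<lambda>t. poisson_fps \<theta> (x + t *\<^sub>R axis i 1))
      (poisson_fps_partial \<theta> i (x + t *\<^sub>R axis i 1)) t" (is ?P)
    and "fps_has_deriv (\<lambda>t. poisson_fps_partial \<theta> i (x + t *\<^sub>R axis i 1))
      (poisson_fps_partial2 \<theta> i (x + t *\<^sub>R axis i 1)) t" (is ?Q)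
proof -
  define y where "y = (\<lambda>t. x + t *\<^sub>R axis i 1)"
  have y: "((\<lambda>t. y t \<bullet> \<theta>) has_real_derivative \<theta> $ i) (at t)"
    "((\<lambda>t. y t \<bullet> y t) has_real_derivative 2 * (y t $ i)) (at t)"
    "((\<lambda>t. y t $ i) has_real_derivative 1) (at t)" for t
    unfolding y_def by (rule has_real_derivative_inner_line)+
  have yt: "x + t *\<^sub>R axis i 1 = y t" for t
    by (simp add: y_def)
  note rules = fps_has_deriv_mult fps_has_deriv_diff fps_has_deriv_add fps_has_deriv_const
    fps_has_deriv_fps_const y
  let ?a = "real CARD('d) / 2"
  have g: "fps_has_deriv (\<lambda>t. gegenbauer a (y t \<bullet> \<theta>) (y t \<bullet> y t)) (fps_const (2 * a)
      * (fps_const (\<theta> $ i) * fps_X - fps_const (y t $ i) * fps_X ^ 2)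
      * gegenbauer (a + 1) (y t \<bullet> \<theta>) (y t \<bullet> y t)) t" for a t
    by (intro fps_has_deriv_gegenbauer y)
  have d: "fps_const (real CARD('d) + 2) = fps_const (real CARD('d)) + 2"
    by (simp flip: fps_const_add numeral_fps_const)
  show ?P
    unfolding poisson_fps_def yt
    by (rule fps_has_deriv_cong, (rule rules g)+)
      (simp add: poisson_fps_partial_def flip: fps_const_neg)
  have "fps_has_deriv (\<lambda>t. fps_const (- 2) * fps_const (y t $ i) * fps_X ^ 2 * gegenbauer ?a (y t \<bullet> \<theta>) (y t \<bullet> y t)
      + (1 - fps_const (y t \<bullet> y t) * fps_X ^ 2) * (fps_const (real CARD('d))
      * (fps_const (\<theta> $ i) * fps_X - fps_const (y t $ i) * fps_X ^ 2)
      * gegenbauer (?a + 1) (y t \<bullet> \<theta>) (y t \<bullet> y t))) (poisson_fps_partial2 \<theta> i (y t)) t"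
    by (rule fps_has_deriv_cong, (rule rules g)+)
      (simp add: poisson_fps_partial2_def Let_def d power2_eq_square algebra_simps
        flip: fps_const_mult fps_const_neg numeral_fps_const)
  then show ?Q
    unfolding poisson_fps_partial_def yt
    by (simp flip: fps_const_mult fps_const_neg numeral_fps_const)
qed

text \<open>Summation over \<open>i\<close> produces the base \<open>W\<close> again: the squares
  \<open>u i ^ 2\<close> add up to \<open>X^2 W\<close>, where \<open>|\<theta>| = 1\<close> enters.
  Since \<open>W\<close> lowers the parameter of \<open>F\<close> by one, everything becomes a
  multiple of \<open>F (d/2 + 1)\<close>, and with the exponent \<open>d/2\<close> the polynomial
  factor cancels.\<close>

lemma sum_poisson_fps_partial2:
  fixes x \<theta> :: "real^'d"
  assumes "norm \<theta> = 1"
  shows "(\<Sum>i\<in>UNIV. poisson_fps_partial2 \<theta> i x) = 0"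
proof -
  define s q where "s = fps_const (x \<bullet> \<theta>)" and "q = fps_const (x \<bullet> x)"
  define F where "F = (\<lambda>a. gegenbauer a (x \<bullet> \<theta>) (x \<bullet> x))"
  define u y where "u = (\<lambda>i. fps_const (\<theta> $ i) * fps_X - fps_const (x $ i) * fps_X ^ 2)"
    and "y = (\<lambda>i. fps_const (x $ i))"
  define W where "W = 1 - 2 * s * fps_X + q * fps_X ^ 2"
  let ?a = "real CARD('d) / 2" and ?d = "fps_const (real CARD('d))"
  have const_sum: "(\<Sum>i\<in>A. fps_const (f i)) = fps_const (sum f A)" for f :: "'d \<Rightarrow> real" and A
    by (induction A rule: infinite_finite_induct) auto
  have yy: "(\<Sum>i\<in>UNIV. y i * y i) = q" and ty: "(\<Sum>i\<in>UNIV. y i * fps_const (\<theta> $ i)) = s"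
    by (simp_all add: y_def q_def s_def const_sum inner_vec_def)
  have tt: "(\<Sum>i\<in>UNIV. fps_const (\<theta> $ i) * fps_const (\<theta> $ i)) = 1"
    using assms by (simp add: const_sum norm_eq_1 inner_vec_def)
  have yu: "(\<Sum>i\<in>UNIV. y i * u i) = s * fps_X - q * fps_X ^ 2"
    unfolding yy[symmetric] ty[symmetric] sum_distrib_right sum_subtractf[symmetric]
    by (intro sum.cong refl, unfold u_def y_def) algebra
  have uu: "(\<Sum>i\<in>UNIV. u i ^ 2) = fps_X ^ 2 * W"
  proof -
    have "(\<Sum>i\<in>UNIV. u i ^ 2) = (\<Sum>i\<in>UNIV. fps_const (\<theta> $ i) * fps_const (\<theta> $ i)) * fps_X ^ 2
      - 2 * (\<Sum>i\<in>UNIV. y i * fps_const (\<theta> $ i)) * fps_X ^ 3 + (\<Sum>i\<in>UNIV. y i * y i) * fps_X ^ 4"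
      unfolding sum_distrib_right sum_distrib_left sum_subtractf[symmetric] sum.distrib[symmetric]
      by (intro sum.cong refl, unfold u_def y_def) algebra
    then show ?thesis
      unfolding yy ty tt W_def by algebra
  qed
  have W1: "W * F (a + 1) = F a" for a
    unfolding W_def s_def q_def F_def gegenbauer_mult[symmetric, of a]
    by (simp flip: fps_const_mult numeral_fps_const)
  have F2: "W * F (?a + 2) = F (?a + 1)" and F1: "W * F (?a + 1) = F ?a"
    using W1[of "?a + 1"] W1[of ?a] by (simp_all add: add.assoc)
  have d: "of_nat CARD('d) = ?d"
    by (simp add: fps_of_nat)
  have "(\<Sum>i\<in>UNIV. poisson_fps_partial2 \<theta> i x)
    = (\<Sum>i\<in>UNIV. - 2 * fps_X ^ 2 * F ?a - 4 * ?d * fps_X ^ 2 * (y i * u i) * F (?a + 1)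
       - ?d * (1 - q * fps_X ^ 2) * fps_X ^ 2 * F (?a + 1)
       + ?d * (?d + 2) * (1 - q * fps_X ^ 2) * u i ^ 2 * F (?a + 2))"
    by (simp add: poisson_fps_partial2_def Let_def u_def y_def F_def q_def)
  also have "\<dots> = - 2 * ?d * fps_X ^ 2 * F ?a - 4 * ?d * fps_X ^ 2 * (s * fps_X - q * fps_X ^ 2) * F (?a + 1)
       - ?d * ?d * (1 - q * fps_X ^ 2) * fps_X ^ 2 * F (?a + 1)
       + ?d * (?d + 2) * (1 - q * fps_X ^ 2) * (fps_X ^ 2 * W) * F (?a + 2)"
    unfolding sum.distrib sum_subtractf sum_distrib_left[symmetric] sum_distrib_right[symmetric] yu uu
    by (simp add: d mult_ac)
  also have "\<dots> = 0"
  proof -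
    have "- 2 * d * X\<^sup>2 * (W * A) - 4 * d * X\<^sup>2 * (s * X - q * X\<^sup>2) * A - d * d * (1 - q * X\<^sup>2) * X\<^sup>2 * A
        + d * (d + 2) * (1 - q * X\<^sup>2) * (X\<^sup>2 * W) * B = 0"
      if "W * B = A" "W = 1 - 2 * s * X + q * X\<^sup>2" for d X W A B :: "real fps"
    proof -
      have "d * (d + 2) * (1 - q * X\<^sup>2) * (X\<^sup>2 * W) * B = d * (d + 2) * (1 - q * X\<^sup>2) * X\<^sup>2 * A"
        unfolding that(1)[symmetric] by (simp add: mult_ac)
      then show ?thesis
        unfolding that(2) by (simp add: algebra_simps)
    qed
    from this[OF F2, of fps_X ?d] show ?thesis
      unfolding F1 by (simp add: W_def)
  qed
  finally show ?thesis .
qed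

lemma partial_deriv_poisson_fps:
  "partial_deriv i (\<lambda>x. complex_of_real (fps_nth (poisson_fps \<theta> x) n)) x
    = of_real (fps_nth (poisson_fps_partial \<theta> i x) n)"
  "partial_deriv i (\<lambda>x. complex_of_real (fps_nth (poisson_fps_partial \<theta> i x) n)) x
    = of_real (fps_nth (poisson_fps_partial2 \<theta> i x) n)"
  using poisson_fps_has_deriv[where x = x and t = 0]
  unfolding partial_deriv_def fps_has_deriv_def
  by (auto intro!: vector_derivative_at has_vector_derivative_of_real
      simp: has_real_derivative_iff_has_vector_derivative[symmetric])

lemma poisson_fps_harmonic:
  fixes \<theta> :: "real^'d"
  assumes "norm \<theta> = 1"
  shows "(\<lambda>x. complex_of_real (fps_nth (poisson_fps \<theta> x) n)) \<in> harmonic_space n"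
proof -
  have 2: "real_polynomial_function (\<lambda>x::real^'d. x \<bullet> x)"
    unfolding inner_vec_def
    by (intro real_polynomial_function_sum) (auto intro: real_polynomial_function.intros(4) real_polynomial_function_coord)
  have nth: "fps_nth (poisson_fps \<theta> x) n = fps_nth (gegenbauer (CARD('d) / 2) (x \<bullet> \<theta>) (x \<bullet> x)) n
      - (if n < 2 then 0 else (x \<bullet> x) * fps_nth (gegenbauer (CARD('d) / 2) (x \<bullet> \<theta>) (x \<bullet> x)) (n - 2))" for x
    by (simp add: poisson_fps_def left_diff_distrib mult.assoc fps_X_power_mult_nth)
  have "real_polynomial_function (\<lambda>x. fps_nth (poisson_fps \<theta> x) n)"
    unfolding nth
    by (cases "n < 2") (auto intro!: real_polynomial_function_diff gegenbauer_nth_polynomial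
        real_polynomial_function.intros(2,4) 2)
  moreover have "fps_nth (poisson_fps \<theta> (c *\<^sub>R x)) n = c ^ n * fps_nth (poisson_fps \<theta> x) n" for c x
  proof -
    have *: "(c *\<^sub>R x) \<bullet> (c *\<^sub>R x) = c\<^sup>2 * (x \<bullet> x)" "(c *\<^sub>R x) \<bullet> \<theta> = c * (x \<bullet> \<theta>)"
      by (simp_all add: power2_eq_square)
    have "c ^ n = c\<^sup>2 * c ^ (n - 2)" if "\<not> n < 2"
      using that by (metis le_add_diff_inverse not_less power_add)
    then show ?thesis
      unfolding nth * gegenbauer_nth_scale by (cases "n < 2") (simp_all add: algebra_simps)
  qed
  moreover have "laplacian (\<lambda>x. complex_of_real (fps_nth (poisson_fps \<theta> x) n)) x = 0" for x
  proof -
    have "laplacian (\<lambda>x. complex_of_real (fps_nth (poisson_fps \<theta> x) n)) x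
      = (\<Sum>i\<in>UNIV. of_real (fps_nth (poisson_fps_partial2 \<theta> i x) n))"
      unfolding laplacian_def by (simp add: partial_deriv_poisson_fps[abs_def])
    also have "\<dots> = of_real (fps_nth (\<Sum>i\<in>UNIV. poisson_fps_partial2 \<theta> i x) n)"
      by (simp add: fps_sum_nth)
    finally show ?thesis
      using assms by (simp add: sum_poisson_fps_partial2)
  qed
  ultimately show ?thesis
    by (auto simp: harmonic_space_def intro: polynomial_function_of_real)
qed

section \<open>Generating functions on the unit disc\<close>

text \<open>The logarithm inside \<open>disc_power\<close> is an arbitrary choice. The difference
  \<open>D\<close> of two candidates satisfies \<open>exp (D u) = 1\<close>, so its derivative
  vanishes; it is constant on the convex disc and zero at the origin.\<close>

lemma disc_power_eq:
  assumes L: "L holomorphic_on ball 0 1" "L 0 = 0" "\<And>u. u \<in> ball 0 1 \<Longrightarrow> exp (L u) = g u"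
    and w: "norm w < 1"
  shows "disc_power g a w = exp (of_real a * L w)"
proof -
  define L' where "L' = (SOME L. L holomorphic_on ball 0 1 \<and> L 0 = 0 \<and> (\<forall>u\<in>ball 0 1. exp (L u) = g u))"
  have "L' holomorphic_on ball 0 1 \<and> L' 0 = 0 \<and> (\<forall>u\<in>ball 0 1. exp (L' u) = g u)"
    unfolding L'_def by (rule someI[of _ L]) (use L in auto)
  then have L': "L' holomorphic_on ball 0 1" "L' 0 = 0" "\<And>u. u \<in> ball 0 1 \<Longrightarrow> exp (L' u) = g u"
    by auto
  define D where "D = (\<lambda>u. L' u - L u)"
  have holo: "D holomorphic_on ball 0 1"
    unfolding D_def by (intro holomorphic_intros L L')
  have exp_D: "exp (D u) = 1" if "u \<in> ball 0 1" for u
    using L(3)[OF that] L'(3)[OF that] by (simp add: D_def exp_diff) (metis exp_not_eq_zero)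
  have "(D has_field_derivative 0) (at u within ball 0 1)" if u: "u \<in> ball 0 1" for u
  proof -
    have D: "(D has_field_derivative deriv D u) (at u)"
      using holo u by (intro holomorphic_derivI) auto
    have "((\<lambda>u. exp (D u)) has_field_derivative exp (D u) * deriv D u) (at u)"
      by (rule DERIV_chain2[OF DERIV_exp D])
    moreover have "((\<lambda>u. exp (D u)) has_field_derivative 0) (at u)"
      by (rule has_field_derivative_transform_within_open[of "\<lambda>_. 1" _ _ "ball 0 1"]) (use u exp_D in auto)
    ultimately have "deriv D u = 0"
      by (metis DERIV_unique exp_not_eq_zero mult_eq_0_iff)
    then show ?thesis
      using D by (simp add: has_field_derivative_at_within)
  qed
  then obtain c where "\<And>u. u \<in> ball 0 1 \<Longrightarrow> D u = c"
    using has_field_derivative_zero_constant[OF convex_ball] by metis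
  then have "D w = D 0"
    using w by simp
  then have "L' w = L w"
    using L(2) L'(2) by (simp add: D_def)
  then show ?thesis
    by (simp add: disc_power_def L'_def)
qed

section \<open>The logarithm of \<open>1 - 2 u cos \<phi> + u^2\<close> on the disc\<close>

text \<open>On the disc both linear factors have positive real part, so each principal logarithm is
  holomorphic there. The exponential of the sum is the quadratic with roots
  \<open>exp (\<i> \<phi>)\<close> and \<open>exp (- \<i> \<phi>)\<close>.\<close>

definition disc_log :: "real \<Rightarrow> complex \<Rightarrow> complex" where
  "disc_log \<phi> u = Ln (1 - exp (\<i> * of_real \<phi>) * u) + Ln (1 - exp (- (\<i> * of_real \<phi>)) * u)"

lemma Re_one_minus_pos:
  assumes "norm (c * u) < 1"
  shows "Re (1 - c * u) > 0"
  using complex_Re_le_cmod[of "c * u"] assms by simp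

lemma disc_factor_pos:
  assumes "norm u < 1"
  shows "Re (1 - exp (\<i> * of_real \<phi>) * u) > 0" "Re (1 - exp (- (\<i> * of_real \<phi>)) * u) > 0"
  using assms by (intro Re_one_minus_pos; simp add: norm_mult)+

lemma disc_log_holomorphic: "disc_log \<phi> holomorphic_on ball 0 1"
  unfolding disc_log_def
  by (intro holomorphic_intros) (auto dest: disc_factor_pos[of _ \<phi>] simp: complex_nonpos_Reals_iff)

lemma disc_log_0 [simp]: "disc_log \<phi> 0 = 0"
  by (simp add: disc_log_def)

lemma disc_factors:
  "(1 - exp (\<i> * of_real \<phi>) * u) * (1 - exp (- (\<i> * of_real \<phi>)) * u) = 1 - 2 * u * of_real (cos \<phi>) + u\<^sup>2"
proof -
  have "exp (\<i> * of_real \<phi>) * exp (- (\<i> * of_real \<phi>)) = 1"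
    by (simp flip: exp_add)
  moreover have "exp (\<i> * of_real \<phi>) + exp (- (\<i> * of_real \<phi>)) = 2 * of_real (cos \<phi>)"
    using cos_exp_eq[of "of_real \<phi>"] by (simp add: cos_of_real field_simps)
  ultimately show ?thesis
    by algebra
qed

lemma exp_disc_log:
  assumes "norm u < 1"
  shows "exp (disc_log \<phi> u) = 1 - 2 * u * of_real (cos \<phi>) + u\<^sup>2"
proof -
  have "1 - exp (\<i> * of_real \<phi>) * u \<noteq> 0" "1 - exp (- (\<i> * of_real \<phi>)) * u \<noteq> 0"
    using disc_factor_pos[OF assms, of \<phi>] by force+
  then show ?thesis
    by (simp add: disc_log_def exp_add flip: disc_factors)
qed

lemma disc_power_quadratic:
  assumes "norm w < 1"
  shows "disc_power (\<lambda>u. 1 - 2 * u * of_real (cos \<phi>) + u\<^sup>2) a w = exp (of_real a * disc_log \<phi> w)"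
    and "disc_power (\<lambda>u. (1 - exp (\<i> * of_real \<phi>) * u) * (1 - exp (- (\<i> * of_real \<phi>)) * u)) a w
      = exp (of_real a * disc_log \<phi> w)"
  using assms
  by (auto intro!: disc_power_eq disc_log_holomorphic simp: exp_disc_log disc_factors)

lemma deriv_disc_log:
  assumes "norm u < 1"
  shows "(disc_log \<phi> has_field_derivative
    (2 * u - 2 * of_real (cos \<phi>)) / (1 - 2 * u * of_real (cos \<phi>) + u\<^sup>2)) (at u)"
proof -
  have D: "(disc_log \<phi> has_field_derivative deriv (disc_log \<phi>) u) (at u)"
    using assms by (intro holomorphic_derivI[OF disc_log_holomorphic]) auto
  have "((\<lambda>u. exp (disc_log \<phi> u)) has_field_derivative exp (disc_log \<phi> u) * deriv (disc_log \<phi>) u) (at u)"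
    by (rule DERIV_chain2[OF DERIV_exp D])
  moreover have "((\<lambda>u. exp (disc_log \<phi> u)) has_field_derivative 2 * u - 2 * of_real (cos \<phi>)) (at u)"
    by (rule has_field_derivative_transform_within_open[of "\<lambda>u. 1 - 2 * u * of_real (cos \<phi>) + u\<^sup>2" _ _ "ball 0 1"])
      (use assms in \<open>auto simp: exp_disc_log intro!: derivative_eq_intros\<close>)
  ultimately have "exp (disc_log \<phi> u) * deriv (disc_log \<phi>) u = 2 * u - 2 * of_real (cos \<phi>)"
    by (rule DERIV_unique)
  then have "deriv (disc_log \<phi>) u = (2 * u - 2 * of_real (cos \<phi>)) / exp (disc_log \<phi> u)"
    by (simp add: field_simps)
  then show ?thesis
    using D assms by (simp add: exp_disc_log)
qed

text \<open>The Wronskian-type expression \<open>F' G - F G'\<close> vanishes, so the quotient of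
  \<open>F\<close> by \<open>G\<close> has derivative zero; in characteristic zero it is the
  constant 1 fixed by the initial coefficients.\<close>

lemma fps_linear_ODE_unique:
  fixes F G V W :: "'a::field_char_0 fps"
  assumes F: "W * fps_deriv F = V * F" and G: "W * fps_deriv G = V * G"
    and W: "W \<noteq> 0" and 0: "fps_nth F 0 = fps_nth G 0" "fps_nth G 0 \<noteq> 0"
  shows "F = G"
proof -
  have "W * (fps_deriv F * G - F * fps_deriv G) = 0"
    using F G by algebra
  then have eq: "fps_deriv F * G - F * fps_deriv G = 0"
    using W by simp
  have inv: "G * inverse G = 1"
    using 0 by (simp add: inverse_mult_eq_1')
  have "fps_deriv (F * inverse G) = fps_deriv F * inverse G - F * (fps_deriv G * (inverse G)\<^sup>2)"
    using 0 by (simp add: fps_inverse_deriv)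
  also have "\<dots> = (fps_deriv F * G - F * fps_deriv G) * (inverse G)\<^sup>2"
    using inv by algebra
  finally have "F * inverse G = fps_const (fps_nth (F * inverse G) 0)"
    unfolding eq mult_zero_left fps_deriv_eq_0_iff .
  also have "\<dots> = 1"
    using 0 by simp
  finally have "F * (G * inverse G) = G"
    by (simp add: mult_ac)
  then show ?thesis
    by (simp add: inv)
qed

text \<open>The bridge from the analytic power to the formal one: both solve
  \<open>W h' = V h\<close> with value 1 at the origin.\<close>

lemma has_fps_expansion_gegenbauer:
  "(\<lambda>u. exp (- (of_real a * disc_log \<phi> u))) has_fps_expansion gegenbauer (of_real a) (of_real (cos \<phi>)) 1"
proof -
  define h where "h = (\<lambda>u. exp (- (of_real a * disc_log \<phi> u)))"
  define t where "t = complex_of_real (cos \<phi>)"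
  define H where "H = fps_expansion h 0"
  let ?W = "1 - fps_const (2 * t) * fps_X + fps_const 1 * fps_X ^ 2"
  let ?V = "fps_const (2 * of_real a) * (fps_const t - fps_const 1 * fps_X)"
  let ?K = "gegenbauer (complex_of_real a) t 1"
  have "h holomorphic_on ball 0 1"
    unfolding h_def by (intro holomorphic_intros disc_log_holomorphic)
  then have H: "h has_fps_expansion H"
    unfolding H_def by (intro has_fps_expansion_fps_expansion[of "ball 0 1"]) auto
  have "(\<lambda>u. (1 - 2 * t * u + 1 * u ^ 2) * deriv h u) has_fps_expansion ?W * fps_deriv H"
    by (intro fps_expansion_intros H)
  moreover have "(\<lambda>u. (1 - 2 * t * u + 1 * u ^ 2) * deriv h u) has_fps_expansion ?V * H"
  proof -
    have 1: "(\<lambda>u. 2 * of_real a * (t - 1 * u) * h u) has_fps_expansion ?V * H"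
      by (intro fps_expansion_intros H)
    have 2: "\<forall>\<^sub>F u in nhds 0. 2 * of_real a * (t - 1 * u) * h u = (1 - 2 * t * u + 1 * u ^ 2) * deriv h u"
    proof (rule eventually_nhds_in_open[of "ball 0 1", THEN eventually_mono])
      fix u :: complex assume "u \<in> ball 0 1"
      then have u: "norm u < 1" by simp
      have nz: "1 - 2 * u * t + u\<^sup>2 \<noteq> 0"
        using exp_disc_log[OF u, of \<phi>] by (metis exp_not_eq_zero t_def)
      have "(h has_field_derivative h u * - (of_real a * ((2 * u - 2 * t) / (1 - 2 * u * t + u\<^sup>2)))) (at u)"
        unfolding h_def t_def
        by (rule DERIV_chain2[OF DERIV_exp DERIV_minus[OF DERIV_cmult[OF deriv_disc_log[OF u]]]])
      then have "deriv h u = h u * - (of_real a * ((2 * u - 2 * t) / (1 - 2 * u * t + u\<^sup>2)))"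
        by (rule DERIV_imp_deriv)
      then show "2 * of_real a * (t - 1 * u) * h u = (1 - 2 * t * u + 1 * u ^ 2) * deriv h u"
        using nz by (simp add: field_simps)
    qed auto
    show ?thesis
      using has_fps_expansion_cong[OF 2 refl, THEN iffD1, OF 1] .
  qed
  ultimately have ode_H: "?W * fps_deriv H = ?V * H"
    by (rule fps_expansion_unique_complex)
  \<comment> \<open>Differentiation turns parameter \<open>a\<close> into \<open>a + 1\<close>, and
    multiplication by the quadratic brings it back to \<open>a\<close>.\<close>
  have ode_K: "?W * fps_deriv ?K = ?V * ?K"
    unfolding fps_deriv_gegenbauer by (simp only: mult.left_commute[of ?W ?V] gegenbauer_mult)
  have "fps_nth H 0 = h 0"
    using has_fps_expansion_imp_0_eq_fps_nth_0[OF H] by simp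
  moreover have "?W \<noteq> 0"
  proof
    assume "?W = 0"
    then have "fps_nth ?W 0 = fps_nth 0 0"
      by (rule arg_cong)
    then show False
      by simp
  qed
  ultimately have "H = ?K"
    by (intro fps_linear_ODE_unique[OF ode_H ode_K]) (simp_all add: h_def)
  then show ?thesis
    using H by (simp add: h_def t_def)
qed

lemma has_fps_expansion_sums:
  assumes "f holomorphic_on ball 0 1" "f has_fps_expansion F" "norm w < 1"
  shows "(\<lambda>n. fps_nth F n * w ^ n) sums f w"
  using holomorphic_power_series[OF assms(1), of w] assms(2,3)
  by (simp add: fps_nth_fps_expansion)

lemma has_fps_expansion_bound:
  assumes "f holomorphic_on ball 0 1" "f has_fps_expansion F" "0 < r" "r < 1"
    and "\<And>u. norm u = r \<Longrightarrow> norm (f u) \<le> B"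
  shows "norm (fps_nth F n) \<le> B / r ^ n"
proof -
  have "norm ((deriv ^^ n) f 0) \<le> fact n * B / r ^ n"
    by (rule Cauchy_inequality)
      (use assms in \<open>auto intro!: holomorphic_on_subset[OF assms(1)] holomorphic_on_imp_continuous_on[OF holomorphic_on_subset[OF assms(1)]]\<close>)
  then show ?thesis
    by (simp add: fps_nth_fps_expansion[OF assms(2)] norm_divide field_simps)
qed

lemma gegenbauer_sums:
  assumes "norm w < 1"
  shows "(\<lambda>n. of_real (fps_nth (gegenbauer a (cos \<phi>) 1) n) * w ^ n) sums exp (- (of_real a * disc_log \<phi> w))"
proof -
  have "(\<lambda>u. exp (- (of_real a * disc_log \<phi> u))) holomorphic_on ball 0 1"
    by (intro holomorphic_intros disc_log_holomorphic)
  from has_fps_expansion_sums[OF this has_fps_expansion_gegenbauer assms] show ?thesis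
    using gegenbauer_nth_of_real[of a "cos \<phi>" 1, where ?'a = complex] by simp
qed

text \<open>At a real point the two linear factors are complex conjugates, so
  \<open>disc_log\<close> is \<open>2 * Re (Ln z)\<close>. The quadratic is then the exponential of
  a real number, which also shows that it is positive.\<close>

lemma disc_log_of_real:
  assumes "\<bar>r\<bar> < 1"
  shows "disc_log \<phi> (of_real r) = of_real (ln (1 - 2 * r * cos \<phi> + r\<^sup>2))"
    and "1 - 2 * r * cos \<phi> + r\<^sup>2 > 0"
proof -
  have r: "norm (complex_of_real r) < 1"
    using assms by simp
  define z where "z = 1 - exp (\<i> * of_real \<phi>) * of_real r"
  have z: "z \<notin> \<real>\<^sub>\<le>\<^sub>0"
    using disc_factor_pos[OF r, of \<phi>] by (auto simp: z_def complex_nonpos_Reals_iff)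
  have "1 - exp (- (\<i> * of_real \<phi>)) * of_real r = cnj z"
    by (simp add: z_def exp_cnj)
  then have L: "disc_log \<phi> (of_real r) = Ln z + cnj (Ln z)"
    using z by (simp add: disc_log_def z_def[symmetric] cnj_Ln)
  then have *: "disc_log \<phi> (of_real r) = of_real (2 * Re (Ln z))"
    by (simp add: complex_add_cnj)
  have "complex_of_real (exp (2 * Re (Ln z))) = of_real (1 - 2 * r * cos \<phi> + r\<^sup>2)"
    using exp_disc_log[OF r, of \<phi>] unfolding * exp_of_real by simp
  then have E: "exp (2 * Re (Ln z)) = 1 - 2 * r * cos \<phi> + r\<^sup>2"
    using of_real_eq_iff by blast
  show "1 - 2 * r * cos \<phi> + r\<^sup>2 > 0"
    unfolding E[symmetric] by simp
  show "disc_log \<phi> (of_real r) = of_real (ln (1 - 2 * r * cos \<phi> + r\<^sup>2))"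
    unfolding E[symmetric] * by simp
qed

lemma exp_disc_log_of_real:
  assumes "\<bar>r\<bar> < 1"
  shows "exp (- (of_real a * disc_log \<phi> (of_real r))) = of_real ((1 - 2 * r * cos \<phi> + r\<^sup>2) powr (- a))"
  using disc_log_of_real[OF assms, of \<phi>]
  by (simp add: powr_def flip: exp_of_real)

lemma Re_disc_log_ge:
  assumes "norm u < 1"
  shows "Re (disc_log \<phi> u) \<ge> 2 * ln (1 - norm u)"
proof -
  have "ln (1 - norm u) \<le> Re (Ln (1 - c * u))" if "norm c = 1" for c
  proof -
    have "1 - norm u \<le> norm (1 - c * u)"
      using norm_triangle_ineq2[of 1 "c * u"] that by (simp add: norm_mult)
    moreover from this assms have "1 - c * u \<noteq> 0"
      by auto
    ultimately show ?thesis
      using assms by simp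
  qed
  from this[of "exp (\<i> * of_real \<phi>)"] this[of "exp (- (\<i> * of_real \<phi>))"] show ?thesis
    by (simp add: disc_log_def)
qed

text \<open>Again the defining choice has to be pinned down: two continuations agree on
  \<open>[0, 1)\<close>, which accumulates at the interior point 0, so the identity theorem
  applies.\<close>

lemma r_complexification_eq:
  assumes F: "F holomorphic_on ball 0 1" "\<And>r. r \<in> {0..<1} \<Longrightarrow> F (of_real r) = of_real (f r)"
    and w: "norm w < 1"
  shows "r_complexification f w = F w"
proof -
  define F' where "F' = r_complexification f"
  have "F' holomorphic_on ball 0 1 \<and> (\<forall>r\<in>{0..<1}. F' (of_real r) = of_real (f r))"
    unfolding F'_def r_complexification_def by (rule someI[of _ F]) (use F in auto)
  then have F': "F' holomorphic_on ball 0 1" "\<And>r. r \<in> {0..<1} \<Longrightarrow> F' (of_real r) = of_real (f r)"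
    by auto
  have "F' w - F w = 0"
  proof (rule analytic_continuation[of "\<lambda>w. F' w - F w" "ball 0 1" "of_real ` {0..<1}" 0])
    show "(\<lambda>w. F' w - F w) holomorphic_on ball 0 1"
      by (intro holomorphic_intros F F')
    show "(0::complex) islimpt of_real ` {0..<1}"
      unfolding islimpt_approachable
    proof (intro allI impI)
      fix e :: real assume "e > 0"
      then have "min (e / 2) (1 / 2) \<in> {0..<1}" "min (e / 2) (1 / 2) > 0" "min (e / 2) (1 / 2) < e"
        by auto
      then show "\<exists>x'\<in>of_real ` {0..<1}. x' \<noteq> (0::complex) \<and> dist x' 0 < e"
        by (intro bexI[of _ "of_real (min (e / 2) (1 / 2))"]) (auto simp: dist_norm)
    qed
  qed (use w F F' in auto)
  then show ?thesis
    by (simp add: F'_def)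
qed

text \<open>The \<open>THE\<close> asks for uniqueness of power series coefficients near 0. A
  nonzero coefficient of the difference would make 0 an isolated zero of a function that vanishes
  identically. The argument has the form \<open>cos \<phi>\<close> because convergence comes from
  \<open>disc_log\<close>.\<close>

lemma P_poly_eq:
  "P_poly a k (cos \<phi>) = fps_nth (gegenbauer a (cos \<phi>) 1) k"
proof -
  let ?g = "\<lambda>r. (1 - 2 * r * cos \<phi> + r\<^sup>2) powr (- a)"
  define c where "c = fps_nth (gegenbauer a (cos \<phi>) 1)"
  have c: "(\<lambda>n. c n * r ^ n) sums ?g r" if "\<bar>r\<bar> < 1" for r
  proof -
    have "(\<lambda>n. complex_of_real (c n * r ^ n)) sums of_real (?g r)"
      using gegenbauer_sums[of "of_real r" a \<phi>] that by (simp add: c_def exp_disc_log_of_real)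
    then show ?thesis
      by (simp only: sums_of_real_iff)
  qed
  have "(THE p. \<forall>\<^sub>F r in nhds 0. (\<lambda>n. p n * r ^ n) sums ?g r) = c"
  proof (rule the_equality)
    show "\<forall>\<^sub>F r in nhds 0. (\<lambda>n. c n * r ^ n) sums ?g r"
      using c by (intro eventually_nhds_in_open[of "ball 0 1", THEN eventually_mono]) auto
  next
    fix p assume "\<forall>\<^sub>F r in nhds 0. (\<lambda>n. p n * r ^ n) sums ?g r"
    then obtain e where e: "e > 0" "\<And>r. \<bar>r\<bar> < e \<Longrightarrow> (\<lambda>n. p n * r ^ n) sums ?g r"
      by (auto simp: eventually_nhds_metric dist_real_def)
    have "(\<lambda>n. (p n - c n) * r ^ n) sums 0" if "\<bar>r\<bar> < min e 1" for r
      using sums_diff[OF e(2)[of r] c[of r]] that by (simp add: algebra_simps)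
    then have powser: "\<And>r. norm (r - 0) < min e 1 \<Longrightarrow> (\<lambda>n. (p n - c n) * (r - 0) ^ n) sums 0"
      by simp
    have "p n - c n = 0" for n
    \<comment> \<open>\<open>powser_0_nonzero\<close> isolates the zero only by means of a
      coefficient of positive index; the constant coefficient is read off at
      \<open>r = 0\<close>.\<close>
    proof (cases "n = 0")
      case True
      then show ?thesis
        using powser[of 0] e(1) by (simp add: powser_sums_zero_iff)
    next
      case False
      show ?thesis
      proof (rule ccontr)
        assume "p n - c n \<noteq> 0"
        then obtain d where "d > 0" "\<And>z::real. z \<in> cball 0 d - {0} \<Longrightarrow> (0::real) \<noteq> 0"
          using powser_0_nonzero[of "min e 1" 0 "\<lambda>n. p n - c n" "\<lambda>_. 0" n] powser e(1) False by auto
        then show False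
          by (metis DiffI dist_0_norm mem_cball order_refl real_norm_def abs_of_pos singletonD less_irrefl)
      qed
    qed
    then show "p = c"
      by auto
  qed
  then show ?thesis
    by (simp add: P_poly_def c_def)
qed

section \<open>The reproducing property\<close>

text \<open>The kernel before division by the total mass, in terms of the angle. It is the common
  value to which the closed forms, the series and the continuation are reduced.\<close>

definition poisson_function :: "nat \<Rightarrow> real \<Rightarrow> complex \<Rightarrow> complex" where
  "poisson_function d \<phi> w = (1 - w\<^sup>2) * exp (- (of_real (d / 2) * disc_log \<phi> w))"

lemma poisson_function_holomorphic: "poisson_function d \<phi> holomorphic_on ball 0 1"
  unfolding poisson_function_def by (intro holomorphic_intros disc_log_holomorphic)

lemma nth_one_minus_X_square_mult:
  fixes F :: "'a::comm_ring_1 fps"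
  shows "fps_nth ((1 - fps_const q * fps_X ^ 2) * F) n = fps_nth F n - (if n < 2 then 0 else q * fps_nth F (n - 2))"
proof -
  have "(1 - fps_const q * fps_X ^ 2) * F = F - fps_const q * (fps_X ^ 2 * F)"
    by (simp only: left_diff_distrib mult.assoc mult_1_left)
  then show ?thesis
    by (simp add: fps_X_power_mult_nth)
qed

section \<open>The Poisson kernel at a fixed pair of unit vectors\<close>

context
  fixes \<theta> x :: "real^'d" and \<phi> :: real
  assumes \<theta>: "norm \<theta> = 1" and x: "norm x = 1" and \<phi>: "cos \<phi> = x \<bullet> \<theta>"
begin

lemma poisson_function_expansion:
  "poisson_function CARD('d) \<phi> has_fps_expansion Abs_fps (\<lambda>n. of_real (fps_nth (poisson_fps \<theta> x) n))"
proof -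
  let ?G = "gegenbauer (complex_of_real (CARD('d) / 2)) (of_real (cos \<phi>)) 1"
  have "poisson_function CARD('d) \<phi> has_fps_expansion (1 - fps_const 1 * fps_X ^ 2) * ?G"
    unfolding poisson_function_def
    by (rule has_fps_expansion_mult[OF _ has_fps_expansion_gegenbauer])
      (auto intro!: fps_expansion_intros)
  moreover have "(1 - fps_const 1 * fps_X ^ 2) * ?G = Abs_fps (\<lambda>n. of_real (fps_nth (poisson_fps \<theta> x) n))"
  proof (rule fps_ext)
    fix n
    have "x \<bullet> x = 1"
      using x by (simp add: norm_eq_1)
    then show "fps_nth ((1 - fps_const 1 * fps_X ^ 2) * ?G) n
        = fps_nth (Abs_fps (\<lambda>n. of_real (fps_nth (poisson_fps \<theta> x) n))) n"
      unfolding poisson_fps_def nth_one_minus_X_square_mult fps_nth_Abs_fps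
      using gegenbauer_nth_of_real[of "CARD('d) / 2" "cos \<phi>" 1, where ?'a = complex] \<phi> by simp
  qed
  ultimately show ?thesis
    by simp
qed

lemma poisson_fps_sums:
  assumes "norm w < 1"
  shows "(\<lambda>n. of_real (fps_nth (poisson_fps \<theta> x) n) * w ^ n) sums poisson_function CARD('d) \<phi> w"
  using has_fps_expansion_sums[OF poisson_function_holomorphic poisson_function_expansion assms] by simp

text \<open>Cauchy's inequality on the circle of radius \<open>r\<close>: there
  \<open>|1 - u^2| \<le> 2\<close>, and each linear factor is at least \<open>1 - r\<close> in
  modulus, so the power contributes at most \<open>(1 - r)^(-d)\<close>. What matters later is that
  the bound does not depend on \<open>x\<close>.\<close>

lemma poisson_fps_bound:
  assumes "0 < r" "r < 1"
  shows "\<bar>fps_nth (poisson_fps \<theta> x) n\<bar> \<le> 2 * exp (- (CARD('d) * ln (1 - r))) / r ^ n"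
proof -
  have "norm (poisson_function CARD('d) \<phi> u) \<le> 2 * exp (- (CARD('d) * ln (1 - r)))" if "norm u = r" for u
  proof -
    have "norm (1 - u\<^sup>2) \<le> 1 + r\<^sup>2"
      using norm_triangle_ineq4[of 1 "u\<^sup>2"] that by (simp add: norm_power)
    also have "\<dots> \<le> 2"
      using assms power_le_one[of r 2] by simp
    finally have "norm (1 - u\<^sup>2) \<le> 2" .
    moreover have "norm (exp (- (of_real (CARD('d) / 2) * disc_log \<phi> u))) \<le> exp (- (CARD('d) * ln (1 - r)))"
    proof -
      have "CARD('d) / 2 * (2 * ln (1 - r)) \<le> CARD('d) / 2 * Re (disc_log \<phi> u)"
        using Re_disc_log_ge[of u \<phi>] that assms by (intro mult_left_mono) auto
      then show ?thesis
        by simp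
    qed
    ultimately show ?thesis
      unfolding poisson_function_def norm_mult by (intro mult_mono) auto
  qed
  from has_fps_expansion_bound[OF poisson_function_holomorphic poisson_function_expansion assms this]
  show ?thesis
    by simp
qed

lemma norm_diff_scaled_square:
  shows "(norm (\<theta> - r *\<^sub>R x))\<^sup>2 = 1 - 2 * r * cos \<phi> + r\<^sup>2"
proof -
  have "\<theta> \<bullet> \<theta> = 1" "x \<bullet> x = 1"
    using \<theta> x by (simp_all add: norm_eq_1)
  then show ?thesis
    unfolding power2_norm_eq_inner \<phi>
    by (simp add: inner_diff_left inner_diff_right inner_commute algebra_simps power2_eq_square)
qed

lemma poisson_function_of_real:
  assumes "\<bar>r\<bar> < 1"
  shows "poisson_function CARD('d) \<phi> (of_real r) = of_real ((1 - r\<^sup>2) / norm (\<theta> - r *\<^sub>R x) ^ CARD('d))"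
proof -
  let ?N = "norm (\<theta> - r *\<^sub>R x)"
  have pos: "?N\<^sup>2 > 0"
    using disc_log_of_real(2)[OF assms, of \<phi>] norm_diff_scaled_square by simp
  then have N: "?N > 0"
    by simp
  have "(1 - 2 * r * cos \<phi> + r\<^sup>2) powr (- (CARD('d) / 2)) = (?N powr 2) powr (- (CARD('d) / 2))"
    using N norm_diff_scaled_square[of r] by simp
  also have "\<dots> = ?N powr (- CARD('d))"
    by (simp only: powr_powr) simp
  also have "\<dots> = 1 / ?N ^ CARD('d)"
    using N by (simp add: powr_minus powr_realpow divide_inverse)
  finally show ?thesis
    unfolding poisson_function_def exp_disc_log_of_real[OF assms] by simp
qed

end

lemma ex_angle:
  fixes \<theta> x :: "real^'d"
  assumes "norm \<theta> = 1" "norm x = 1"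
  shows "\<exists>\<phi>. cos \<phi> = x \<bullet> \<theta>"
proof -
  have "\<bar>x \<bullet> \<theta>\<bar> \<le> 1"
    using Cauchy_Schwarz_ineq2[of x \<theta>] assms by simp
  then have "cos (arccos (x \<bullet> \<theta>)) = x \<bullet> \<theta>"
    by (intro cos_arccos) auto
  then show ?thesis ..
qed

lemma poisson_fps_real_sums:
  fixes \<theta> x :: "real^'d"
  assumes "norm \<theta> = 1" "norm x = 1" "\<bar>r\<bar> < 1"
  shows "(\<lambda>n. fps_nth (poisson_fps \<theta> x) n * r ^ n) sums ((1 - r\<^sup>2) / norm (\<theta> - r *\<^sub>R x) ^ CARD('d))"
proof -
  obtain \<phi> where \<phi>: "cos \<phi> = x \<bullet> \<theta>"
    using ex_angle assms by blast
  have "(\<lambda>n. complex_of_real (fps_nth (poisson_fps \<theta> x) n * r ^ n)) sums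
      of_real ((1 - r\<^sup>2) / norm (\<theta> - r *\<^sub>R x) ^ CARD('d))"
    using poisson_fps_sums[OF assms(1,2) \<phi>, of "of_real r"]
      poisson_function_of_real[OF assms(1,2) \<phi> assms(3)] assms(3) by simp
  then show ?thesis
    by (simp only: sums_of_real_iff)
qed

lemma poisson_fps_nth_0 [simp]: "fps_nth (poisson_fps \<theta> x) 0 = 1"
  by (simp add: poisson_fps_def)

lemma const_in_harmonic_space_0: "(\<lambda>x. 1) \<in> harmonic_space 0"
proof -
  have "partial_deriv i (\<lambda>x. c) = (\<lambda>x. 0)" for i :: 'a and c
    by (rule ext) (simp add: partial_deriv_eq[OF has_derivative_const])
  then show ?thesis
    by (simp add: harmonic_space_def laplacian_def)
qed

section \<open>Integrals of the Poisson kernel and the limit at the boundary\<close>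

context sphere_measure
begin

context
  fixes \<theta> :: "real^'d"
  assumes \<theta>: "norm \<theta> = 1"
begin

lemma continuous_on_poisson_fps: "continuous_on S (\<lambda>x. fps_nth (poisson_fps \<theta> x) n)"
proof -
  have "polynomial_function (\<lambda>x. complex_of_real (fps_nth (poisson_fps \<theta> x) n))"
    using poisson_fps_harmonic[OF \<theta>, of n] by (simp add: harmonic_space_def)
  then show ?thesis
    by (intro continuous_on_polymonial_function) (simp add: polynomial_function_complex_iff real_polynomial_function_eq)
qed

lemma continuous_on_poisson_kernel:
  assumes "0 \<le> r" "r < 1"
  shows "continuous_on (sphere 0 1) (\<lambda>x. (1 - r\<^sup>2) / norm (\<theta> - r *\<^sub>R x) ^ CARD('d))"
proof -
  have "\<theta> \<noteq> r *\<^sub>R x" if "norm x = 1" for x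
    using that \<theta> assms by auto
  then show ?thesis
    by (intro continuous_intros) auto
qed

text \<open>Termwise integration: for fixed \<open>r < 1\<close> the terms are dominated by a
  geometric series, uniformly on the sphere.\<close>

lemma integral_poisson_kernel_sums:
  fixes f :: "real^'d \<Rightarrow> complex"
  assumes f: "continuous_on (sphere 0 1) f" and r: "0 \<le> r" "r < 1"
  shows "(\<lambda>n. of_real (r ^ n) * (\<integral>x. of_real (fps_nth (poisson_fps \<theta> x) n) * f x \<partial>M)) sums
    (\<integral>x. of_real ((1 - r\<^sup>2) / norm (\<theta> - r *\<^sub>R x) ^ CARD('d)) * f x \<partial>M)"
proof -
  \<comment> \<open>A radius strictly between \<open>r\<close> and 1. The Cauchy bound on its circle
    leaves the ratio \<open>r / \<rho> < 1\<close>.\<close>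
  define \<rho> where "\<rho> = (1 + r) / 2"
  have \<rho>: "0 < \<rho>" "\<rho> < 1" "r < \<rho>"
    using r by (auto simp: \<rho>_def)
  have "bounded (f ` sphere 0 1)"
    by (intro compact_imp_bounded compact_continuous_image f compact_sphere)
  then obtain C where C: "\<And>x. x \<in> sphere 0 1 \<Longrightarrow> norm (f x) \<le> C"
    unfolding bounded_iff by blast
  define B where "B = 2 * exp (- (CARD('d) * ln (1 - \<rho>)))"
  define T where "T = (\<lambda>n x. of_real (fps_nth (poisson_fps \<theta> x) n * r ^ n) * f x)"
  have T_bound: "norm (T n x) \<le> B * C * (r / \<rho>) ^ n" if "x \<in> space M" for n x
  proof -
    have x: "norm x = 1"
      using that by (simp add: space_M)
    obtain \<phi> where \<phi>: "cos \<phi> = x \<bullet> \<theta>"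
      using ex_angle \<theta> x by blast
    have "norm (T n x) = \<bar>fps_nth (poisson_fps \<theta> x) n\<bar> * r ^ n * norm (f x)"
      using r by (simp add: T_def norm_mult norm_power abs_mult)
    also have "\<dots> \<le> (B / \<rho> ^ n) * r ^ n * C"
      using poisson_fps_bound[OF \<theta> x \<phi> \<rho>(1,2), of n] C[of x] x r \<rho>(1)
      by (intro mult_mono) (auto simp: B_def)
    finally show ?thesis
      by (simp add: power_divide mult_ac)
  qed
  have geo: "summable (\<lambda>n. B * C * (r / \<rho>) ^ n)"
    using r \<rho> by (intro summable_mult summable_geometric) simp
  have T_int: "integrable M (T n)" for n
    unfolding T_def by (intro integrable_M continuous_intros continuous_on_poisson_fps f)
  have "(\<lambda>n. \<integral>x. T n x \<partial>M) sums (\<integral>x. (\<Sum>n. T n x) \<partial>M)"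
  proof (rule sums_integral)
    show "integrable M (T n)" for n by (rule T_int)
    show "AE x in M. summable (\<lambda>n. norm (T n x))"
      by (intro AE_I2 summable_comparison_test'[OF geo]) (use T_bound in auto)
    show "summable (\<lambda>n. \<integral>x. norm (T n x) \<partial>M)"
    proof (rule summable_comparison_test')
      show "summable (\<lambda>n. B * C * (r / \<rho>) ^ n * measure M (space M))"
        using geo by (rule summable_mult2)
      fix n
      have "(\<integral>x. norm (T n x) \<partial>M) \<le> (\<integral>x. B * C * (r / \<rho>) ^ n \<partial>M)"
        using T_int T_bound by (intro integral_mono) auto
      then show "norm (\<integral>x. norm (T n x) \<partial>M) \<le> B * C * (r / \<rho>) ^ n * measure M (space M)"
        by (simp add: mult_ac)
    qed
  qed
  moreover have "(\<integral>x. T n x \<partial>M) = of_real (r ^ n) * (\<integral>x. of_real (fps_nth (poisson_fps \<theta> x) n) * f x \<partial>M)" for n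
    unfolding T_def by (subst integral_mult_right_zero[symmetric]) (simp add: mult_ac)
  moreover have "(\<integral>x. (\<Sum>n. T n x) \<partial>M) = (\<integral>x. of_real ((1 - r\<^sup>2) / norm (\<theta> - r *\<^sub>R x) ^ CARD('d)) * f x \<partial>M)"
  proof (rule Bochner_Integration.integral_cong[OF refl])
    fix x assume "x \<in> space M"
    then have "norm x = 1"
      by (simp add: space_M)
    from poisson_fps_real_sums[OF \<theta> this, of r]
    have "(\<lambda>n. T n x) sums (of_real ((1 - r\<^sup>2) / norm (\<theta> - r *\<^sub>R x) ^ CARD('d)) * f x)"
      unfolding T_def using r by (intro sums_mult2 sums_of_real) auto
    then show "(\<Sum>n. T n x) = of_real ((1 - r\<^sup>2) / norm (\<theta> - r *\<^sub>R x) ^ CARD('d)) * f x"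
      by (rule sums_unique[symmetric])
  qed
  ultimately show ?thesis
    by simp
qed

lemma integral_poisson_kernel_harmonic:
  assumes d: "CARD('d) \<ge> 2" and f: "f \<in> harmonic_space k" and r: "0 \<le> r" "r < 1"
  shows "(\<integral>x. of_real ((1 - r\<^sup>2) / norm (\<theta> - r *\<^sub>R x) ^ CARD('d)) * f x \<partial>M)
    = of_real (r ^ k) * (\<integral>x. of_real (fps_nth (poisson_fps \<theta> x) k) * f x \<partial>M)"
proof -
  have "polynomial_function f"
    using f by (simp add: harmonic_space_def)
  then have "continuous_on (sphere 0 1) f"
    by (rule continuous_on_polymonial_function)
  from integral_poisson_kernel_sums[OF this r]
  have "(\<lambda>n. of_real (r ^ n) * (\<integral>x. of_real (fps_nth (poisson_fps \<theta> x) n) * f x \<partial>M)) sums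
    (\<integral>x. of_real ((1 - r\<^sup>2) / norm (\<theta> - r *\<^sub>R x) ^ CARD('d)) * f x \<partial>M)" .
  moreover have "(\<lambda>n. of_real (r ^ n) * (\<integral>x. of_real (fps_nth (poisson_fps \<theta> x) n) * f x \<partial>M)) sums
      (of_real (r ^ k) * (\<integral>x. of_real (fps_nth (poisson_fps \<theta> x) k) * f x \<partial>M))"
  proof -
    have "(\<integral>x. of_real (fps_nth (poisson_fps \<theta> x) n) * f x \<partial>M) = 0" if "n \<noteq> k" for n
      using harmonic_spaces_orthogonal[OF d poisson_fps_harmonic[OF \<theta>] f that] .
    then have "(\<lambda>n. of_real (r ^ n) * (\<integral>x. of_real (fps_nth (poisson_fps \<theta> x) n) * f x \<partial>M)) =
        (\<lambda>n. if n = k then of_real (r ^ n) * (\<integral>x. of_real (fps_nth (poisson_fps \<theta> x) n) * f x \<partial>M) else 0)"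
      by (intro ext) (metis mult_zero_right)
    then show ?thesis
      by (rule ssubst) (rule sums_single)
  qed
  ultimately show ?thesis
    by (rule sums_unique2)
qed

text \<open>The integral of the kernel against \<open>f\<close> is exactly \<open>r ^ k * A\<close>,
  so the approximate identity gives \<open>A\<close> itself in the limit. Instead of a convergence
  statement for integrals, an explicit error bound is proved for every \<open>r < 1\<close> and then
  passed to \<open>r = 1\<close>.\<close>

lemma poisson_fps_reproducing:
  assumes d: "CARD('d) \<ge> 2" and f: "f \<in> harmonic_space k"
  shows "(\<integral>x. of_real (fps_nth (poisson_fps \<theta> x) k) * f x \<partial>M) = of_real (measure M (space M)) * f \<theta>"
proof -
  define m where "m = measure M (space M)"
  define A where "A = (\<integral>x. of_real (fps_nth (poisson_fps \<theta> x) k) * f x \<partial>M)"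
  define K where "K = (\<lambda>r x. (1 - r\<^sup>2) / norm (\<theta> - r *\<^sub>R x) ^ CARD('d))"
  have "polynomial_function f"
    using f by (simp add: harmonic_space_def)
  then have cont: "continuous_on S f" for S
    by (rule continuous_on_polymonial_function)
  have Kcont: "continuous_on (sphere 0 1) (K r)" if "0 \<le> r" "r < 1" for r
    unfolding K_def by (rule continuous_on_poisson_kernel[OF that])
  have K_pos: "K r x \<ge> 0" if "0 \<le> r" "r < 1" for r x
    using that power_le_one[of r 2] by (simp add: K_def)
  \<comment> \<open>The constant harmonic of degree 0 yields the mass: coefficient 0 of
    \<open>poisson_fps\<close> is 1 and \<open>r ^ 0 = 1\<close>.\<close>
  have K_int: "(\<integral>x. K r x \<partial>M) = m" if "0 \<le> r" "r < 1" for r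
  proof -
    have "(\<integral>x. complex_of_real (K r x) \<partial>M) = of_real m"
      using integral_poisson_kernel_harmonic[OF d const_in_harmonic_space_0 that] by (simp add: K_def m_def scaleR_conv_of_real)
    then show ?thesis
      by simp
  qed
  have est: "norm (A - of_real m * f \<theta>) \<le> e * m" if "e > 0" for e
  proof -
    have "isCont f \<theta>"
      using cont[of UNIV] by (simp add: continuous_on_eq_continuous_at)
    then obtain \<delta> where \<delta>: "\<delta> > 0" "\<And>x. dist x \<theta> < \<delta> \<Longrightarrow> dist (f x) (f \<theta>) < e"
      using \<open>e > 0\<close> unfolding continuous_at_eps_delta by metis
    have "bounded ((\<lambda>x. f x - f \<theta>) ` sphere 0 1)"
      by (intro compact_imp_bounded compact_continuous_image continuous_intros cont compact_sphere)
    then obtain C where C: "C > 0" "\<And>x. x \<in> sphere 0 1 \<Longrightarrow> norm (f x - f \<theta>) \<le> C"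
      unfolding bounded_pos by blast
    \<comment> \<open>Away from \<open>\<theta>\<close> the distance \<open>|\<theta> - r x|\<close>
      is at least \<open>\<delta> / 2\<close>, so the kernel is at most
      \<open>(1 - r^2) (2 / \<delta>)^d\<close>, while \<open>C\<close> bounds the oscillation of
      \<open>f\<close>.\<close>
    define D where "D = (2 / \<delta>) ^ CARD('d) * C"
    have bound: "norm (of_real (r ^ k) * A - of_real m * f \<theta>) \<le> e * m + (1 - r\<^sup>2) * D * m" if r: "0 \<le> r" "r < 1" for r
    proof -
      have pointwise: "K r x * norm (f x - f \<theta>) \<le> K r x * e + (1 - r\<^sup>2) * D" if x: "norm x = 1" for x
      proof (cases "dist x \<theta> < \<delta>")
        case True
        then have "K r x * norm (f x - f \<theta>) \<le> K r x * e"
          using \<delta>(2)[of x] K_pos[OF r] by (intro mult_left_mono) (auto simp: dist_norm)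
        moreover have "(1 - r\<^sup>2) * D \<ge> 0"
          using r power_le_one[of r 2] \<delta> C by (simp add: D_def)
        ultimately show ?thesis by simp
      next
        case False
        have "norm (x - r *\<^sub>R x) = 1 - r"
        proof -
          have "x - r *\<^sub>R x = (1 - r) *\<^sub>R x"
            by (simp add: scaleR_diff_left)
          then show ?thesis
            using x r by simp
        qed
        moreover have "1 - r \<le> norm (\<theta> - r *\<^sub>R x)"
          using norm_triangle_ineq2[of \<theta> "r *\<^sub>R x"] \<theta> x r by simp
        moreover have "norm (x - \<theta>) \<le> norm (x - r *\<^sub>R x) + norm (\<theta> - r *\<^sub>R x)"
          using norm_triangle_ineq4[of "x - r *\<^sub>R x" "\<theta> - r *\<^sub>R x"] by simp
        \<comment> \<open>Both \<open>|x - r x| = 1 - r\<close> and the bound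
          \<open>1 - r \<le> |\<theta> - r x|\<close> are used: together
          \<open>|x - \<theta>| \<le> 2 |\<theta> - r x|\<close>.\<close>
        ultimately have far: "\<delta> / 2 \<le> norm (\<theta> - r *\<^sub>R x)"
          using False by (simp add: dist_norm)
        then have "(\<delta> / 2) ^ CARD('d) \<le> norm (\<theta> - r *\<^sub>R x) ^ CARD('d)"
          using \<delta>(1) by (intro power_mono) auto
        moreover have "norm (\<theta> - r *\<^sub>R x) > 0"
          using far \<delta>(1) by linarith
        ultimately have "K r x \<le> (1 - r\<^sup>2) / (\<delta> / 2) ^ CARD('d)"
          unfolding K_def using r power_le_one[of r 2] \<delta>(1)
          by (intro divide_left_mono mult_pos_pos zero_less_power) auto
        also have "\<dots> = (1 - r\<^sup>2) * (2 / \<delta>) ^ CARD('d)"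
          by (simp add: power_divide)
        finally have "K r x * norm (f x - f \<theta>) \<le> (1 - r\<^sup>2) * (2 / \<delta>) ^ CARD('d) * C"
          using C(2)[of x] x K_pos[OF r, of x] by (intro mult_mono) auto
        moreover have "K r x * e \<ge> 0"
          using K_pos[OF r, of x] \<open>e > 0\<close> by simp
        ultimately show ?thesis
          by (simp add: D_def mult.assoc)
      qed
      have "of_real (r ^ k) * A - of_real m * f \<theta> = (\<integral>x. of_real (K r x) * f x \<partial>M) - (\<integral>x. of_real (K r x) * f \<theta> \<partial>M)"
      proof -
        have "(\<integral>x. of_real (K r x) * f \<theta> \<partial>M) = of_real m * f \<theta>"
          using K_int[OF r] by (simp only: integral_mult_left_zero integral_complex_of_real)
        moreover have "(\<integral>x. of_real (K r x) * f x \<partial>M) = of_real (r ^ k) * A"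
          unfolding K_def A_def by (rule integral_poisson_kernel_harmonic[OF d f r])
        ultimately show ?thesis
          by (simp only:)
      qed
      also have "\<dots> = (\<integral>x. of_real (K r x) * f x - of_real (K r x) * f \<theta> \<partial>M)"
        by (intro Bochner_Integration.integral_diff[symmetric] integrable_M continuous_intros Kcont r cont)
      also have "norm \<dots> \<le> (\<integral>x. norm (of_real (K r x) * f x - of_real (K r x) * f \<theta>) \<partial>M)"
        by (rule integral_norm_bound)
      also have "\<dots> \<le> (\<integral>x. K r x * e + (1 - r\<^sup>2) * D \<partial>M)"
      proof (intro integral_mono integrable_M continuous_intros Kcont r cont)
        fix x assume "x \<in> space M"
        then have "norm x = 1" by (simp add: space_M)
        moreover have "norm (of_real (K r x) * f x - of_real (K r x) * f \<theta>) = K r x * norm (f x - f \<theta>)"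
          using K_pos[OF r] by (simp add: norm_mult flip: right_diff_distrib)
        ultimately show "norm (of_real (K r x) * f x - of_real (K r x) * f \<theta>) \<le> K r x * e + (1 - r\<^sup>2) * D"
          using pointwise by simp
      qed
      also have "\<dots> = e * m + (1 - r\<^sup>2) * D * m"
        using integrable_M[OF Kcont[OF r]] K_int[OF r] by (simp add: m_def mult_ac)
      finally show ?thesis .
    qed
    \<comment> \<open>Both sides are continuous in \<open>r\<close>, so the estimate survives the
      left limit at 1, where the term with \<open>D\<close> disappears. The unevaluated
      \<open>1 ^ k\<close> and \<open>1 - 1^2\<close> match the limits produced by
      substitution.\<close>
    have "norm (of_real (1 ^ k) * A - of_real m * f \<theta>) \<le> e * m + (1 - 1\<^sup>2) * D * m"
    proof (rule tendsto_le[of "at_left (1::real)"])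
      show "((\<lambda>r. e * m + (1 - r\<^sup>2) * D * m) \<longlongrightarrow> e * m + (1 - 1\<^sup>2) * D * m) (at_left 1)"
        by (intro tendsto_intros)
      show "((\<lambda>r. norm (of_real (r ^ k) * A - of_real m * f \<theta>)) \<longlongrightarrow> norm (of_real (1 ^ k) * A - of_real m * f \<theta>)) (at_left 1)"
        by (intro tendsto_intros)
      show "\<forall>\<^sub>F r in at_left 1. norm (of_real (r ^ k) * A - of_real m * f \<theta>) \<le> e * m + (1 - r\<^sup>2) * D * m"
        using eventually_at_left_real[OF zero_less_one] by eventually_elim (use bound in auto)
    qed simp
    then show ?thesis
      by simp
  qed
  have "norm (A - of_real m * f \<theta>) \<le> 0"
  proof (rule field_le_epsilon)
    fix e :: real assume "e > 0"
    then have "norm (A - of_real m * f \<theta>) \<le> e / (m + 1) * m"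
      by (intro est) (simp add: m_def add_nonneg_pos)
    also have "\<dots> \<le> e"
    proof -
      have "m \<ge> 0" by (simp add: m_def)
      then show ?thesis
        using \<open>e > 0\<close> by (simp add: pos_divide_le_eq algebra_simps)
    qed
    finally show "norm (A - of_real m * f \<theta>) \<le> 0 + e"
      by simp
  qed
  then show ?thesis
    by (simp add: A_def m_def)
qed

end

end

section \<open>The kernels\<close>

text \<open>Under \<open>x / |x|\<close> the whole sphere has the punctured ball as preimage, whose
  volume is that of the ball; the scale factor \<open>d\<close> completes the cone measure.\<close>

lemma sphere_area_eq: "sphere_area TYPE('d::finite) = real CARD('d) * unit_ball_vol (real CARD('d))"
proof -
  let ?B = "ball (0::real^'d) 1 - {0}"
  let ?N = "restrict_space lborel ?B"
  let ?S = "restrict_space borel (sphere (0::real^'d) 1)"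
  have meas: "(\<lambda>x. x /\<^sub>R norm x) \<in> measurable ?N ?S"
  proof (intro measurable_restrict_space2)
    show "(\<lambda>x. x /\<^sub>R norm x) \<in> space ?N \<rightarrow> sphere 0 1"
      by (auto simp: space_restrict_space)
    show "(\<lambda>x. x /\<^sub>R norm x) \<in> borel_measurable ?N"
      by (intro measurable_restrict_space1) simp
  qed
  have pre: "(\<lambda>x. x /\<^sub>R norm x) -` sphere 0 1 \<inter> space ?N = ?B"
    by (auto simp: space_restrict_space)
  have "emeasure (distr ?N ?S (\<lambda>x. x /\<^sub>R norm x)) (sphere 0 1) = emeasure ?N ?B"
  proof -
    have "sphere 0 1 \<in> sets ?S"
      by (auto simp: sets_restrict_space intro!: image_eqI[of _ _ UNIV])
    from emeasure_distr[OF meas this] show ?thesis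
      by (simp only: pre)
  qed
  also have "\<dots> = emeasure lborel ?B"
    by (intro emeasure_restrict_space) auto
  also have "\<dots> = emeasure lborel (ball (0::real^'d) 1)"
    by (intro emeasure_Diff_null_set) auto
  also have "\<dots> = ennreal (unit_ball_vol (real CARD('d)))"
    by (simp add: emeasure_ball)
  finally have "emeasure (surface_measure :: (real^'d) measure) (sphere 0 1)
      = ennreal (real CARD('d) * unit_ball_vol (real CARD('d)))"
    by (simp add: surface_measure_def ennreal_mult' ennreal_of_nat_eq_real_of_nat)
  then show ?thesis
    by (simp add: sphere_area_def measure_def)
qed

lemma sphere_area_pos: "sphere_area TYPE('d::finite) > 0"
  by (simp add: sphere_area_eq)

text \<open>Apply \<open>X d/dX + a\<close> to \<open>(1 - 2 s X + q X^2)^(-a)\<close>: the linear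
  terms in \<open>s\<close> cancel and \<open>a (1 - q X^2)\<close> remains in front of the power
  \<open>-a-1\<close>. With \<open>a = (d - 2) / 2\<close> and \<open>q = 1\<close> the right side
  is a Poisson coefficient, and \<open>(k + a) / a\<close> is the factor
  \<open>(2k + d - 2) / (d - 2)\<close>.\<close>

lemma gegenbauer_shift:
  fixes a s q :: "'a::field_char_0"
  shows "(of_nat n + a) * fps_nth (gegenbauer a s q) n
    = a * fps_nth ((1 - fps_const q * fps_X ^ 2) * gegenbauer (a + 1) s q) n"
proof -
  have "fps_X * fps_deriv (gegenbauer a s q) + fps_const a * gegenbauer a s q
    = fps_const a * ((1 - fps_const q * fps_X ^ 2) * gegenbauer (a + 1) s q)"
  proof -
    have "X * (2 * A * (S - Q * X) * G) + A * ((1 - 2 * S * X + Q * X\<^sup>2) * G) = A * ((1 - Q * X\<^sup>2) * G)"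
      for X A S Q G :: "'a fps"
      by algebra
    from this[of fps_X "fps_const a" "fps_const s" "fps_const q" "gegenbauer (a + 1) s q"]
    moreover have D: "fps_deriv (gegenbauer a s q)
        = 2 * fps_const a * (fps_const s - fps_const q * fps_X) * gegenbauer (a + 1) s q"
      by (simp add: fps_deriv_gegenbauer flip: fps_const_mult numeral_fps_const)
    moreover have M: "gegenbauer a s q
        = (1 - 2 * fps_const s * fps_X + fps_const q * fps_X\<^sup>2) * gegenbauer (a + 1) s q"
      unfolding gegenbauer_mult[of s q a, symmetric] by (simp flip: fps_const_mult numeral_fps_const)
    ultimately show ?thesis
      unfolding D unfolding M by (simp only:)
  qed
  from arg_cong[OF this, of "\<lambda>F. fps_nth F n"] show ?thesis
    by (cases n) (simp_all add: algebra_simps)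
qed

lemma poisson_function_two:
  assumes "norm w < 1"
  shows "poisson_function 2 \<phi> w = (1 - w\<^sup>2) / (1 - 2 * w * of_real (cos \<phi>) + w\<^sup>2)"
  using exp_disc_log[OF assms, of \<phi>] by (simp add: poisson_function_def exp_minus divide_inverse)

text \<open>The cosine is the mean of the powers of \<open>\<alpha>\<close> and
  \<open>\<beta>\<close>, so the series splits into two geometric ones;
  \<open>\<alpha> * \<beta> = 1\<close> simplifies the combined fraction.\<close>

lemma cosine_power_series:
  fixes w :: complex
  assumes w: "norm w < 1"
  shows "summable (\<lambda>k. w ^ Suc k * of_real (cos (real (Suc k) * \<phi>)))"
    and "1 + 2 * (\<Sum>k. w ^ Suc k * of_real (cos (real (Suc k) * \<phi>)))
      = (1 - w\<^sup>2) / (1 - 2 * w * of_real (cos \<phi>) + w\<^sup>2)"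
proof -
  define \<alpha> \<beta> where "\<alpha> = exp (\<i> * of_real \<phi>)" and "\<beta> = exp (- (\<i> * of_real \<phi>))"
  have nz: "1 - \<alpha> * w \<noteq> 0" "1 - \<beta> * w \<noteq> 0"
    using disc_factor_pos[OF w, of \<phi>] unfolding \<alpha>_def \<beta>_def
    by (metis less_irrefl zero_complex.simps(1))+
  have "\<alpha> * \<beta> = 1"
    by (simp add: \<alpha>_def \<beta>_def flip: exp_add)
  have geo: "(\<lambda>k. (c * w) ^ Suc k) sums (c * w / (1 - c * w))" if "norm c = 1" for c
    using sums_mult[OF geometric_sums[of "c * w"], of "c * w"] that w by (simp add: norm_mult)
  have series: "w ^ Suc k * of_real (cos (real (Suc k) * \<phi>)) = ((\<alpha> * w) ^ Suc k + (\<beta> * w) ^ Suc k) / 2" for k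
  proof -
    have "complex_of_real (cos (real (Suc k) * \<phi>)) = (\<alpha> ^ Suc k + \<beta> ^ Suc k) / 2"
      unfolding \<alpha>_def \<beta>_def exp_of_nat_mult[symmetric] cos_of_real[symmetric] cos_exp_eq
      by (simp add: algebra_simps)
    then show ?thesis
      by (simp only: power_mult_distrib) (simp add: algebra_simps add_divide_distrib)
  qed
  have sums: "(\<lambda>k. w ^ Suc k * of_real (cos (real (Suc k) * \<phi>))) sums
      ((\<alpha> * w / (1 - \<alpha> * w) + \<beta> * w / (1 - \<beta> * w)) / 2)"
    unfolding series by (intro sums_divide sums_add geo) (simp_all add: \<alpha>_def \<beta>_def)
  then show "summable (\<lambda>k. w ^ Suc k * of_real (cos (real (Suc k) * \<phi>)))"
    by (rule sums_summable)
  have "1 + 2 * ((\<alpha> * w / (1 - \<alpha> * w) + \<beta> * w / (1 - \<beta> * w)) / 2)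
      = (1 - \<alpha> * \<beta> * w\<^sup>2) / ((1 - \<alpha> * w) * (1 - \<beta> * w))"
  proof -
    \<comment> \<open>With \<open>p = 1 - \<alpha> * w\<close> and
      \<open>q = 1 - \<beta> * w\<close> the claim is a rational identity, and the numerator becomes
      \<open>1 - \<alpha> * \<beta> * w^2\<close>.\<close>
    have "1 + 2 * (((1 - p) / p + (1 - q) / q) / 2) = (1 - (1 - p) * (1 - q)) / (p * q)"
      if "p \<noteq> 0" "q \<noteq> 0" for p q :: complex
      using that by (simp add: field_simps)
    from this[OF nz] show ?thesis
      by (simp add: power2_eq_square mult_ac)
  qed
  also have "\<dots> = (1 - w\<^sup>2) / (1 - 2 * w * of_real (cos \<phi>) + w\<^sup>2)"
    by (simp only: \<open>\<alpha> * \<beta> = 1\<close> mult_1_left disc_factors[of \<phi> w, folded \<alpha>_def \<beta>_def])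
  finally show "1 + 2 * (\<Sum>k. w ^ Suc k * of_real (cos (real (Suc k) * \<phi>)))
      = (1 - w\<^sup>2) / (1 - 2 * w * of_real (cos \<phi>) + w\<^sup>2)"
    unfolding sums_unique[OF sums, symmetric] .
qed

lemma poisson_fps_commute:
  assumes "norm \<theta> = 1" "norm x = 1"
  shows "poisson_fps \<theta> x = poisson_fps x \<theta>"
  using assms by (simp add: poisson_fps_def inner_commute norm_eq_1)

text \<open>The term is \<open>v^(2j)\<close> times a term depending on \<open>(k, l)\<close> only.
  Absolute summability is established over \<open>(k, l)\<close> first, then over \<open>j\<close>,
  so iterated summation is legitimate and the sum over \<open>j\<close> is geometric in
  \<open>v^2\<close>. In the application \<open>v\<close> is \<open>\<zeta> * z\<close>.\<close>

lemma triple_series: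
  fixes g :: "nat \<Rightarrow> nat \<Rightarrow> complex" and N :: "nat \<Rightarrow> nat" and v :: complex
  defines "F \<equiv> \<lambda>(j, k, l). v ^ (2 * j + k) * g k l"
    and "I \<equiv> SIGMA j:UNIV. SIGMA k:UNIV. {1..N k}"
  assumes v: "norm v < 1" and summable: "summable (\<lambda>k. norm v ^ k * (\<Sum>l=1..N k. norm (g k l)))"
    and sums: "(\<lambda>k. v ^ k * (\<Sum>l=1..N k. g k l)) sums S"
  shows "(\<lambda>i. norm (F i)) summable_on I" and "infsum F I = 1 / (1 - v\<^sup>2) * S"
proof -
  define H where "H = (\<lambda>(k, l). v ^ k * g k l)"
  define J where "J = (SIGMA k:(UNIV::nat set). {1..N k})"
  have H_norm: "(\<Sum>\<^sub>\<infinity>l\<in>{1..N k}. norm (H (k, l))) = norm v ^ k * (\<Sum>l=1..N k. norm (g k l))" for k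
    by (simp add: H_def norm_mult norm_power sum_distrib_left)
  have H: "(\<lambda>p. norm (H p)) summable_on J"
    unfolding J_def Infinite_Sum.abs_summable_on_Sigma_iff H_norm
    using summable by (auto intro!: summable_nonneg_imp_summable_on simp: abs_mult sum_nonneg abs_of_nonneg)
  have H_infsum: "infsum H J = S"
  proof -
    have "infsum H J = (\<Sum>\<^sub>\<infinity>k. \<Sum>\<^sub>\<infinity>l\<in>{1..N k}. H (k, l))"
      using infsum_Sigma_banach[OF abs_summable_summable[OF H, unfolded J_def]] by (simp only: J_def)
    also have "\<dots> = (\<Sum>\<^sub>\<infinity>k. v ^ k * (\<Sum>l=1..N k. g k l))"
      by (simp add: H_def sum_distrib_left)
    also have "\<dots> = S"
    proof (rule infsumI, rule norm_summable_imp_has_sum[OF _ sums])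
      show "summable (\<lambda>k. norm (v ^ k * (\<Sum>l=1..N k. g k l)))"
        by (rule summable_comparison_test'[OF summable])
          (auto simp: norm_mult norm_power intro!: mult_left_mono norm_sum)
    qed
    finally show ?thesis .
  qed
  have F: "F (j, p) = v ^ (2 * j) * H p" for j p
    by (cases p) (simp add: F_def H_def power_add)
  have v2: "norm (v\<^sup>2) < 1"
    using v by (simp add: norm_power power_less_one_iff)
  have I: "I = Sigma UNIV (\<lambda>j. J)"
    by (simp add: I_def J_def)
  have F_norm: "(\<Sum>\<^sub>\<infinity>p\<in>J. norm (F (j, p))) = norm (v\<^sup>2) ^ j * (\<Sum>\<^sub>\<infinity>p\<in>J. norm (H p))" for j
    by (simp add: F norm_mult norm_power power_mult infsum_cmult_right')
  have geo: "summable (\<lambda>j. norm (v\<^sup>2) ^ j)"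
    using v2 by (intro summable_geometric) simp
  show "(\<lambda>i. norm (F i)) summable_on I"
    unfolding I Infinite_Sum.abs_summable_on_Sigma_iff F_norm
  proof (intro conjI ballI)
    show "(\<lambda>p. norm (F (j, p))) summable_on J" for j
      unfolding F norm_mult by (intro summable_on_cmult_right H)
    show "(\<lambda>j. norm (norm (v\<^sup>2) ^ j * (\<Sum>\<^sub>\<infinity>p\<in>J. norm (H p)))) summable_on UNIV"
      using summable_mult2[OF geo, of "\<Sum>\<^sub>\<infinity>p\<in>J. norm (H p)"]
      by (intro summable_nonneg_imp_summable_on) (auto simp: abs_mult infsum_nonneg)
  qed
  then have "infsum F I = (\<Sum>\<^sub>\<infinity>j. \<Sum>\<^sub>\<infinity>p\<in>J. F (j, p))"
    using infsum_Sigma_banach[OF abs_summable_summable, of F UNIV "\<lambda>j. J"] by (simp only: I)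
  also have "\<dots> = (\<Sum>\<^sub>\<infinity>j. (v\<^sup>2) ^ j * S)"
    by (simp add: F infsum_cmult_right' H_infsum power_mult)
  also have "\<dots> = 1 / (1 - v\<^sup>2) * S"
  proof (rule infsumI, rule norm_summable_imp_has_sum)
    show "summable (\<lambda>j. norm ((v\<^sup>2) ^ j * S))"
      using summable_mult2[OF geo, of "norm S"] by (simp add: norm_mult norm_power)
    show "(\<lambda>j. (v\<^sup>2) ^ j * S) sums (1 / (1 - v\<^sup>2) * S)"
      by (intro sums_mult2 geometric_sums v2)
  qed
  finally show "infsum F I = 1 / (1 - v\<^sup>2) * S" .
qed

section \<open>Orthonormal bases, zonal harmonics and the continued kernel\<close>

context sphere_measure
begin

lemma measure_space_pos: "measure M (space M) > 0"
  using invariant emeasure_eq_measure[of "space M"]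
  by (auto simp: rotation_invariant_def zero_less_measure_iff)

lemma harmonic_continuous: "f \<in> harmonic_space k \<Longrightarrow> continuous_on S f"
  by (auto simp: harmonic_space_def intro: continuous_on_polymonial_function)

text \<open>Induction over the span: adding \<open>c\<close> times the basis element
  \<open>Y m\<close> changes only coefficient \<open>m\<close>, by \<open>c\<close>. Continuity on
  the sphere is carried along so that the integral of a sum can be split.\<close>

lemma orthonormal_expansion:
  assumes Y: "orthonormal_harmonics M k Y" and f: "f \<in> harmonic_space k"
  shows "f x = (\<Sum>l=1..harm_dim TYPE('d) k. (\<integral>y. f y * cnj (Y l y) \<partial>M) * Y l x)"
proof -
  let ?I = "{1..harm_dim TYPE('d) k}"
  have span: "cfun.span (Y ` ?I) = harmonic_space k"
    and ortho: "\<And>l l'. l \<in> ?I \<Longrightarrow> l' \<in> ?I \<Longrightarrow> (\<integral>x. Y l x * cnj (Y l' x) \<partial>M) = (if l = l' then 1 else 0)"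
    using Y by (auto simp: orthonormal_harmonics_def)
  have Y_cont: "continuous_on (sphere 0 1) (Y l)" if "l \<in> ?I" for l
    using that span cfun.span_base[of "Y l" "Y ` ?I"] harmonic_continuous by blast
  have "f \<in> cfun.span (Y ` ?I)"
    using f span by simp
  then have "continuous_on (sphere 0 1) f \<and>
      (\<forall>x. f x = (\<Sum>l\<in>?I. (\<integral>y. f y * cnj (Y l y) \<partial>M) * Y l x))"
  proof (induction rule: cfun.span_induct_alt)
    case base
    then show ?case
      by (simp add: zero_fun_def)
  next
    case (step c y g)
    then obtain m where m: "m \<in> ?I" "y = Y m" and g_cont: "continuous_on (sphere 0 1) g"
      and g: "\<And>x. g x = (\<Sum>l\<in>?I. (\<integral>y. g y * cnj (Y l y) \<partial>M) * Y l x)"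
      by blast
    have "(\<integral>x. (c * Y m x + g x) * cnj (Y l x) \<partial>M) = c * (if m = l then 1 else 0) + (\<integral>x. g x * cnj (Y l x) \<partial>M)"
      if l: "l \<in> ?I" for l
    proof -
      have "(\<integral>x. (c * Y m x + g x) * cnj (Y l x) \<partial>M)
          = (\<integral>x. c * (Y m x * cnj (Y l x)) + g x * cnj (Y l x) \<partial>M)"
        by (simp add: algebra_simps)
      also have "\<dots> = (\<integral>x. c * (Y m x * cnj (Y l x)) \<partial>M) + (\<integral>x. g x * cnj (Y l x) \<partial>M)"
        by (intro Bochner_Integration.integral_add integrable_M continuous_intros Y_cont m g_cont l)
      finally show ?thesis
        using ortho[OF m(1) l] by simp
    qed
    note coeff = this
    have "c * Y m x + g x = (\<Sum>l\<in>?I. (\<integral>x. (c * Y m x + g x) * cnj (Y l x) \<partial>M) * Y l x)" for x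
    proof -
      have "(\<Sum>l\<in>?I. (\<integral>x. (c * Y m x + g x) * cnj (Y l x) \<partial>M) * Y l x)
          = (\<Sum>l\<in>?I. (if l = m then c * Y l x else 0) + (\<integral>x. g x * cnj (Y l x) \<partial>M) * Y l x)"
        by (intro sum.cong refl, subst coeff) (auto simp: distrib_right)
      also have "\<dots> = c * Y m x + (\<Sum>l\<in>?I. (\<integral>x. g x * cnj (Y l x) \<partial>M) * Y l x)"
        using m(1) by (simp add: sum.distrib)
      finally show ?thesis
        unfolding g[of x, symmetric] ..
    qed
    moreover have "continuous_on (sphere 0 1) (\<lambda>x. c * Y m x + g x)"
      by (intro continuous_intros Y_cont m g_cont)
    moreover have eq: "cscale c y + g = (\<lambda>x. c * Y m x + g x)"
      using m(2) by (simp add: plus_fun_def cscale_def)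
    ultimately show ?case
      unfolding eq by blast
  qed
  then show ?thesis
    by blast
qed

lemma addition_formula:
  assumes d: "CARD('d) \<ge> 2" and Y: "orthonormal_harmonics M k Y" and \<theta>: "norm \<theta> = 1"
  shows "(\<Sum>l=1..harm_dim TYPE('d) k. Y l x * cnj (Y l \<theta>))
    = of_real (fps_nth (poisson_fps \<theta> x) k / measure M (space M))"
proof -
  define G where "G = (\<lambda>x. complex_of_real (fps_nth (poisson_fps \<theta> x) k))"
  let ?m = "complex_of_real (measure M (space M))"
  \<comment> \<open>The reproducing identity is bilinear; as \<open>G\<close> is real valued,
    conjugating it for \<open>Y l\<close> gives the Fourier coefficient of \<open>G\<close>.\<close>
  have "(\<integral>y. G y * cnj (Y l y) \<partial>M) = ?m * cnj (Y l \<theta>)" if "l \<in> {1..harm_dim TYPE('d) k}" for l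
  proof -
    have "Y l \<in> harmonic_space k"
      using Y that cfun.span_base[of "Y l" "Y ` {1..harm_dim TYPE('d) k}"]
      by (auto simp: orthonormal_harmonics_def)
    from poisson_fps_reproducing[OF \<theta> d this] have "cnj (\<integral>y. G y * Y l y \<partial>M) = cnj (?m * Y l \<theta>)"
      by (simp add: G_def)
    moreover have "cnj (\<integral>y. G y * Y l y \<partial>M) = (\<integral>y. G y * cnj (Y l y) \<partial>M)"
      unfolding Bochner_Integration.integral_cnj[symmetric] by (simp add: G_def)
    ultimately show ?thesis
      by simp
  qed
  then have "G x = ?m * (\<Sum>l=1..harm_dim TYPE('d) k. Y l x * cnj (Y l \<theta>))"
    using orthonormal_expansion[OF Y, of G x] poisson_fps_harmonic[OF \<theta>, of k]
    by (simp add: G_def sum_distrib_left mult_ac)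
  then show ?thesis
    using measure_space_pos by (simp add: G_def field_simps)
qed

text \<open>Uniqueness for the \<open>THE\<close>: testing a reproducing element against the basis
  forces its coefficients to be \<open>cnj (Y l \<theta>)\<close>, and by
  \<open>orthonormal_expansion\<close> these determine it.\<close>

lemma zonal_eq:
  assumes d: "CARD('d) \<ge> 2" and Y: "orthonormal_harmonics M k Y" and \<theta>: "norm \<theta> = 1"
  shows "zonal M k \<theta> x = of_real (fps_nth (poisson_fps \<theta> x) k / measure M (space M))"
proof -
  let ?m = "measure M (space M)"
  let ?I = "{1..harm_dim TYPE('d) k}"
  define Z where "Z = (\<lambda>x. complex_of_real (fps_nth (poisson_fps \<theta> x) k / ?m))"
  have span: "cfun.span (Y ` ?I) = harmonic_space k"
    using Y by (simp add: orthonormal_harmonics_def)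
  \<comment> \<open>Closure of the harmonic space under scalars is read off from its description as
    a span.\<close>
  have "cscale (of_real (1 / ?m)) (\<lambda>x. of_real (fps_nth (poisson_fps \<theta> x) k)) \<in> harmonic_space k"
    using cfun.span_scale poisson_fps_harmonic[OF \<theta>, of k] unfolding span[symmetric] by blast
  then have Z: "Z \<in> harmonic_space k"
    by (simp add: cscale_def Z_def)
  have repr: "f \<theta> = (\<integral>x. f x * cnj (Z x) \<partial>M)" if "f \<in> harmonic_space k" for f
  proof -
    have "(\<integral>x. f x * cnj (Z x) \<partial>M) = (\<integral>x. of_real (1 / ?m) * (of_real (fps_nth (poisson_fps \<theta> x) k) * f x) \<partial>M)"
      by (simp add: Z_def mult_ac)
    also have "\<dots> = of_real (1 / ?m) * (of_real ?m * f \<theta>)"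
      using poisson_fps_reproducing[OF \<theta> d that] by (simp only: integral_mult_right_zero)
    finally show ?thesis
      using measure_space_pos by simp
  qed
  have "zonal M k \<theta> = Z"
    unfolding zonal_def
  proof (rule the_equality)
    show "Z \<in> harmonic_space k \<and> (\<forall>f\<in>harmonic_space k. f \<theta> = (\<integral>x. f x * cnj (Z x) \<partial>M))"
      using Z repr by blast
  next
    fix Z' assume Z': "Z' \<in> harmonic_space k \<and> (\<forall>f\<in>harmonic_space k. f \<theta> = (\<integral>x. f x * cnj (Z' x) \<partial>M))"
    have "(\<integral>y. W y * cnj (Y l y) \<partial>M) = cnj (Y l \<theta>)"
      if l: "l \<in> ?I" and W: "\<forall>f\<in>harmonic_space k. f \<theta> = (\<integral>x. f x * cnj (W x) \<partial>M)" for l W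
    proof -
      have "Y l \<in> harmonic_space k"
        using span l cfun.span_base[of "Y l" "Y ` ?I"] by auto
      then have "cnj (Y l \<theta>) = cnj (\<integral>x. Y l x * cnj (W x) \<partial>M)"
        using W by simp
      then show ?thesis
        unfolding Bochner_Integration.integral_cnj[symmetric] by (simp add: mult.commute)
    qed
    then have "Z' x = Z x" for x
      using orthonormal_expansion[OF Y, of Z' x] orthonormal_expansion[OF Y Z, of x] Z' repr by simp
    then show "Z' = Z"
      by blast
  qed
  then show ?thesis
    by (simp add: Z_def)
qed

lemma complex_poisson_kernel_eq:
  assumes \<theta>: "norm \<theta> = 1" and \<theta>': "norm \<theta>' = 1" and \<phi>: "cos \<phi> = \<theta> \<bullet> \<theta>'" and w: "norm w < 1"
  shows "complex_poisson_kernel M w \<theta> \<theta>' = of_real (1 / measure M (space M)) * poisson_function CARD('d) \<phi> w"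
  unfolding complex_poisson_kernel_def
proof (rule r_complexification_eq[OF _ _ w])
  show "(\<lambda>w. of_real (1 / measure M (space M)) * poisson_function CARD('d) \<phi> w) holomorphic_on ball 0 1"
    by (intro holomorphic_intros poisson_function_holomorphic)
  show "of_real (1 / measure M (space M)) * poisson_function CARD('d) \<phi> (of_real r) = of_real (poisson_kernel M r \<theta> \<theta>')"
    if "r \<in> {0..<1}" for r
    using poisson_function_of_real[OF \<theta> \<theta>', of \<phi> r] \<phi> that
    by (simp add: poisson_kernel_def inner_commute)
qed

text \<open>The bound \<open>|a b| \<le> |a|^2 + |b|^2\<close> reduces the claim to the diagonal.
  There \<open>addition_formula\<close> turns the sum of squares into a Poisson coefficient, and the
  real Poisson series converges for \<open>r < 1\<close>.\<close>

lemma orthonormal_product_summable: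
  assumes d: "CARD('d) \<ge> 2" and Y: "\<And>k. orthonormal_harmonics M k (Y k)"
    and \<theta>: "norm \<theta> = 1" "norm \<theta>' = 1" and r: "0 \<le> r" "r < 1"
  shows "summable (\<lambda>k. r ^ k * (\<Sum>l=1..harm_dim TYPE('d) k. norm (Y k l \<theta> * cnj (Y k l \<theta>'))))"
proof -
  let ?I = "\<lambda>k. {1..harm_dim TYPE('d) k}"
  have diagonal: "summable (\<lambda>k. r ^ k * (\<Sum>l\<in>?I k. (norm (Y k l \<theta>))\<^sup>2))" if "norm \<theta> = 1" for \<theta>
  proof -
    have "complex_of_real (\<Sum>l\<in>?I k. (norm (Y k l \<theta>))\<^sup>2)
        = of_real (fps_nth (poisson_fps \<theta> \<theta>) k / measure M (space M))" for k
      using addition_formula[OF d Y that, of k \<theta>] by (simp only: of_real_sum complex_norm_square)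
    then have "(\<Sum>l\<in>?I k. (norm (Y k l \<theta>))\<^sup>2) = fps_nth (poisson_fps \<theta> \<theta>) k / measure M (space M)" for k
      by (simp only: of_real_eq_iff)
    moreover have "summable (\<lambda>k. fps_nth (poisson_fps \<theta> \<theta>) k * r ^ k)"
      using poisson_fps_real_sums[OF that that, of r] r by (simp add: sums_iff)
    ultimately show ?thesis
      using summable_divide[of "\<lambda>k. fps_nth (poisson_fps \<theta> \<theta>) k * r ^ k" "measure M (space M)"]
      by (simp add: mult.commute)
  qed
  show ?thesis
  proof (rule summable_comparison_test')
    show "summable (\<lambda>k. r ^ k * (\<Sum>l\<in>?I k. (norm (Y k l \<theta>))\<^sup>2) + r ^ k * (\<Sum>l\<in>?I k. (norm (Y k l \<theta>'))\<^sup>2))"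
      using \<theta> by (intro summable_add diagonal)
    fix k
    have "norm (Y k l \<theta> * cnj (Y k l \<theta>')) \<le> (norm (Y k l \<theta>))\<^sup>2 + (norm (Y k l \<theta>'))\<^sup>2" for l
      using sum_squares_bound[of "norm (Y k l \<theta>)" "norm (Y k l \<theta>')"]
        mult_nonneg_nonneg[OF norm_ge_zero[of "Y k l \<theta>"] norm_ge_zero[of "Y k l \<theta>'"]]
      unfolding norm_mult complex_mod_cnj by linarith
    then have "r ^ k * (\<Sum>l\<in>?I k. norm (Y k l \<theta> * cnj (Y k l \<theta>')))
        \<le> r ^ k * (\<Sum>l\<in>?I k. (norm (Y k l \<theta>))\<^sup>2 + (norm (Y k l \<theta>'))\<^sup>2)"
      using r by (intro mult_left_mono sum_mono) auto
    then show "norm (r ^ k * (\<Sum>l\<in>?I k. norm (Y k l \<theta> * cnj (Y k l \<theta>'))))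
        \<le> r ^ k * (\<Sum>l\<in>?I k. (norm (Y k l \<theta>))\<^sup>2) + r ^ k * (\<Sum>l\<in>?I k. (norm (Y k l \<theta>'))\<^sup>2)"
      using r by (simp add: abs_mult sum.distrib distrib_left sum_nonneg abs_of_nonneg)
  qed
qed

end

theorem proposition17:
  fixes M :: "(real^'d) measure"
    and Y :: "nat \<Rightarrow> nat \<Rightarrow> real^'d \<Rightarrow> complex"
    and \<theta> \<theta>' :: "real^'d"
    and \<phi> :: real
  assumes "CARD('d) \<ge> 2"
    and "rotation_invariant M"
    and "\<And>k. orthonormal_harmonics M k (Y k)"
    and "\<theta> \<in> sphere 0 1" and "\<theta>' \<in> sphere 0 1"
    and "cos \<phi> = \<theta> \<bullet> \<theta>'"
  shows
    "(\<forall>w::complex. norm w < 1 \<longrightarrow>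
        (\<lambda>k. \<Sum>l=1..harm_dim TYPE('d) k. w ^ k * Y k l \<theta> * cnj (Y k l \<theta>'))
          sums (1 / measure M (space M) *
            ((1 - w\<^sup>2) / disc_power (\<lambda>u. 1 - 2 * u * of_real (\<theta> \<bullet> \<theta>') + u\<^sup>2) (CARD('d) / 2) w)) \<and>
        (\<lambda>k. w ^ k * zonal M k \<theta> \<theta>')
          sums (1 / measure M (space M) *
            ((1 - w\<^sup>2) / disc_power (\<lambda>u. 1 - 2 * u * of_real (\<theta> \<bullet> \<theta>') + u\<^sup>2) (CARD('d) / 2) w))) \<and>
     (CARD('d) = 2 \<longrightarrow> (\<forall>w::complex. norm w < 1 \<longrightarrow>
        summable (\<lambda>k. w ^ Suc k * of_real (cos (real (Suc k) * \<phi>))) \<and>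
        complex_poisson_kernel M w \<theta> \<theta>' =
          of_real (sphere_area TYPE('d) / measure M (space M)) *
            (1 / (2 * of_real pi) +
             1 / of_real pi * (\<Sum>k. w ^ Suc k * of_real (cos (real (Suc k) * \<phi>)))) \<and>
        complex_poisson_kernel M w \<theta> \<theta>' =
          of_real (sphere_area TYPE('d) / measure M (space M)) *
            (1 / (2 * of_real pi) * ((1 - w\<^sup>2) / (1 - 2 * w * of_real (cos \<phi>) + w\<^sup>2))))) \<and>
     (CARD('d) > 2 \<longrightarrow> (\<forall>w::complex. norm w < 1 \<longrightarrow>
        (\<lambda>k. of_real (sphere_area TYPE('d) / measure M (space M)) *
             (w ^ k *
              of_real (1 / sphere_area TYPE('d) *
                ((2 * real k + real CARD('d) - 2) / (real CARD('d) - 2))) *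
              of_real (P_poly ((real CARD('d) - 2) / 2) k (cos \<phi>))))
          sums complex_poisson_kernel M w \<theta> \<theta>')) \<and>
     (\<lambda>w. complex_poisson_kernel M w \<theta> \<theta>') holomorphic_on ball 0 1 \<and>
     (\<forall>r\<in>{0..<1}. complex_poisson_kernel M (of_real r) \<theta> \<theta>' = of_real (poisson_kernel M r \<theta> \<theta>')) \<and>
     (\<forall>w::complex. norm w < 1 \<longrightarrow>
        complex_poisson_kernel M w \<theta> \<theta>' =
          1 / measure M (space M) *
            ((1 - w\<^sup>2) / disc_power (\<lambda>u. 1 - 2 * u * of_real (\<theta> \<bullet> \<theta>') + u\<^sup>2) (CARD('d) / 2) w) \<and>
        complex_poisson_kernel M w \<theta> \<theta>' =
          1 / measure M (space M) *
            ((1 - w\<^sup>2) /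
              disc_power (\<lambda>u. (1 - exp (\<i> * of_real \<phi>) * u) * (1 - exp (- (\<i> * of_real \<phi>)) * u))
                (CARD('d) / 2) w)) \<and>
     (\<forall>\<zeta> z::complex. norm (\<zeta> * z) < 1 \<longrightarrow>
        (\<lambda>i. norm (cauchy_term Y \<zeta> \<theta>' z \<theta> i)) summable_on cauchy_index TYPE('d) \<and>
        cauchy_kernel Y \<zeta> \<theta>' z \<theta> =
          1 / (1 - \<zeta>\<^sup>2 * z\<^sup>2) * complex_poisson_kernel M (\<zeta> * z) \<theta> \<theta>' \<and>
        cauchy_kernel Y \<zeta> \<theta>' z \<theta> =
          1 / measure M (space M) *
            (1 / disc_power (\<lambda>u. 1 - 2 * u * of_real (\<theta> \<bullet> \<theta>') + u\<^sup>2) (CARD('d) / 2) (\<zeta> * z)))"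
proof -
  interpret sphere_measure M
    using assms(2) by (rule sphere_measure.intro)
  let ?m = "measure M (space M)"
  let ?p = "poisson_function CARD('d) \<phi>"
  let ?q = "\<lambda>u::complex. 1 - 2 * u * of_real (\<theta> \<bullet> \<theta>') + u\<^sup>2"
  let ?I = "\<lambda>k. {1..harm_dim TYPE('d) k}"
  note d = assms(1) and Y = assms(3) and \<phi> = assms(6)
  have \<theta>: "norm \<theta> = 1" "norm \<theta>' = 1"
    using assms(4,5) by auto
  have \<phi>': "cos \<phi> = \<theta>' \<bullet> \<theta>"
    using \<phi> by (simp add: inner_commute)
  have power: "disc_power ?q a w = exp (of_real a * disc_log \<phi> w)" if "norm w < 1" for a w
    using disc_power_quadratic(1)[OF that, of \<phi> a] by (simp only: \<phi>)
  \<comment> \<open>The two factorised denominators and the continued kernel are all rewritten as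
    \<open>?p\<close>, so that the remaining claims compare series with this one function.\<close>
  have closed: "(1 - w\<^sup>2) / disc_power ?q (CARD('d) / 2) w = ?p w" if "norm w < 1" for w
    unfolding power[OF that] poisson_function_def by (simp only: exp_minus divide_inverse)
  have closed': "(1 - w\<^sup>2) / disc_power (\<lambda>u. (1 - exp (\<i> * of_real \<phi>) * u) * (1 - exp (- (\<i> * of_real \<phi>)) * u))
      (CARD('d) / 2) w = ?p w" if "norm w < 1" for w
    unfolding disc_power_quadratic(2)[OF that] poisson_function_def by (simp only: exp_minus divide_inverse)
  have kernel: "complex_poisson_kernel M w \<theta> \<theta>' = of_real (1 / ?m) * ?p w" if "norm w < 1" for w
    by (rule complex_poisson_kernel_eq[OF \<theta> \<phi> that])
  have coeff_sums: "(\<lambda>k. w ^ k * of_real (fps_nth (poisson_fps \<theta> \<theta>') k / ?m)) sums (of_real (1 / ?m) * ?p w)"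
    if "norm w < 1" for w
    using sums_mult[OF poisson_fps_sums[OF \<theta> \<phi>' that], of "of_real (1 / ?m)"] by (simp add: mult.commute)
  have addition: "(\<Sum>l\<in>?I k. Y k l \<theta> * cnj (Y k l \<theta>')) = of_real (fps_nth (poisson_fps \<theta> \<theta>') k / ?m)" for k
    using addition_formula[OF d Y \<theta>(2), of k \<theta>] by (simp only: poisson_fps_commute[OF \<theta>])
  have harmonic_sums: "(\<lambda>k. \<Sum>l\<in>?I k. w ^ k * Y k l \<theta> * cnj (Y k l \<theta>')) sums (of_real (1 / ?m) * ?p w)"
    if "norm w < 1" for w
    using coeff_sums[OF that] by (simp only: addition[symmetric] sum_distrib_left mult.assoc)
  have zonal_sums: "(\<lambda>k. w ^ k * zonal M k \<theta> \<theta>') sums (of_real (1 / ?m) * ?p w)" if "norm w < 1" for w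
    using coeff_sums[OF that] by (simp only: zonal_eq[OF d Y \<theta>(1)])
  have area: "sphere_area TYPE('d) > 0"
    by (rule sphere_area_pos)
  have two: "summable (\<lambda>k. w ^ Suc k * of_real (cos (real (Suc k) * \<phi>))) \<and>
        complex_poisson_kernel M w \<theta> \<theta>' =
          of_real (sphere_area TYPE('d) / ?m) *
            (1 / (2 * of_real pi) +
             1 / of_real pi * (\<Sum>k. w ^ Suc k * of_real (cos (real (Suc k) * \<phi>)))) \<and>
        complex_poisson_kernel M w \<theta> \<theta>' =
          of_real (sphere_area TYPE('d) / ?m) *
            (1 / (2 * of_real pi) * ((1 - w\<^sup>2) / (1 - 2 * w * of_real (cos \<phi>) + w\<^sup>2)))"
    if d2: "CARD('d) = 2" and w: "norm w < 1" for w
  proof (intro conjI)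
    show "summable (\<lambda>k. w ^ Suc k * of_real (cos (real (Suc k) * \<phi>)))"
      by (rule cosine_power_series(1)[OF w])
    \<comment> \<open>The circle has length \<open>2 pi\<close>, which cancels against the factor
      \<open>1 / (2 pi)\<close> and leaves the normalisation \<open>1 / ?m\<close>.\<close>
    have "sphere_area TYPE('d) = 2 * pi"
      by (simp add: sphere_area_eq d2 unit_ball_vol_2)
    then have prefactor: "of_real (sphere_area TYPE('d) / ?m) * (1 / (2 * of_real pi)) = complex_of_real (1 / ?m)"
      by simp
    show closed_form: "complex_poisson_kernel M w \<theta> \<theta>' =
          of_real (sphere_area TYPE('d) / ?m) *
            (1 / (2 * of_real pi) * ((1 - w\<^sup>2) / (1 - 2 * w * of_real (cos \<phi>) + w\<^sup>2)))"
      unfolding kernel[OF w] d2 poisson_function_two[OF w] mult.assoc[symmetric] prefactor ..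
    have "1 / (2 * of_real pi) + 1 / of_real pi * (\<Sum>k. w ^ Suc k * of_real (cos (real (Suc k) * \<phi>)))
      = 1 / (2 * of_real pi) * (1 + 2 * (\<Sum>k. w ^ Suc k * of_real (cos (real (Suc k) * \<phi>))))"
      by (simp only: distrib_left) simp
    then show "complex_poisson_kernel M w \<theta> \<theta>' =
          of_real (sphere_area TYPE('d) / ?m) *
            (1 / (2 * of_real pi) +
             1 / of_real pi * (\<Sum>k. w ^ Suc k * of_real (cos (real (Suc k) * \<phi>))))"
      unfolding closed_form cosine_power_series(2)[OF w] by (simp only:)
  qed
  have many: "(\<lambda>k. of_real (sphere_area TYPE('d) / ?m) *
             (w ^ k *
              of_real (1 / sphere_area TYPE('d) *
                ((2 * real k + real CARD('d) - 2) / (real CARD('d) - 2))) *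
              of_real (P_poly ((real CARD('d) - 2) / 2) k (cos \<phi>))))
          sums complex_poisson_kernel M w \<theta> \<theta>'"
    if d3: "CARD('d) > 2" and w: "norm w < 1" for w
  proof -
    \<comment> \<open>Chosen so that \<open>a + 1 = d / 2\<close>, the exponent of the kernel;
      \<open>d > 2\<close> makes \<open>a\<close> positive, hence an admissible divisor.\<close>
    define a where "a = (real CARD('d) - 2) / 2"
    have a: "a > 0" "a + 1 = real CARD('d) / 2"
      using d3 by (auto simp: a_def field_simps)
    have "(2 * real k + real CARD('d) - 2) / (real CARD('d) - 2) * P_poly a k (cos \<phi>)
        = fps_nth (poisson_fps \<theta> \<theta>') k" for k
    proof -
      have "\<theta>' \<bullet> \<theta>' = 1"
        using \<theta> by (simp add: norm_eq_1)
      then have *: "(real k + a) * P_poly a k (cos \<phi>) = a * fps_nth (poisson_fps \<theta> \<theta>') k"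
        unfolding P_poly_eq using gegenbauer_shift[of k a "cos \<phi>" 1] \<phi>' by (simp add: a poisson_fps_def)
      have "(2 * real k + real CARD('d) - 2) / (real CARD('d) - 2) = (real k + a) / a"
        using d3 by (simp add: a_def field_simps)
      then have "(2 * real k + real CARD('d) - 2) / (real CARD('d) - 2) * P_poly a k (cos \<phi>)
          = (real k + a) * P_poly a k (cos \<phi>) / a"
        by (simp only: times_divide_eq_left)
      then show ?thesis
        unfolding * using a(1) by simp
    qed
    note coeff = this
    have "of_real (sphere_area TYPE('d) / ?m) *
             (w ^ k *
              of_real (1 / sphere_area TYPE('d) *
                ((2 * real k + real CARD('d) - 2) / (real CARD('d) - 2))) *
              of_real (P_poly ((real CARD('d) - 2) / 2) k (cos \<phi>)))
        = w ^ k * of_real (fps_nth (poisson_fps \<theta> \<theta>') k / ?m)" for k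
    proof -
      have "complex_of_real (A / ?m) * (w ^ k * of_real (1 / A * c) * of_real P) = w ^ k * of_real (c * P / ?m)"
        if "A > 0" for A c P :: real
        using that by simp
      from this[OF area] show ?thesis
        by (simp only: coeff[symmetric] a_def)
    qed
    then show ?thesis
      using coeff_sums[OF w] unfolding kernel[OF w] by (simp only:)
  qed
  have holomorphic: "(\<lambda>w. complex_poisson_kernel M w \<theta> \<theta>') holomorphic_on ball 0 1"
    by (rule holomorphic_transform[of "\<lambda>w. of_real (1 / ?m) * ?p w"])
      (auto simp: kernel simp del: of_real_divide intro!: holomorphic_intros poisson_function_holomorphic)
  have real: "complex_poisson_kernel M (of_real r) \<theta> \<theta>' = of_real (poisson_kernel M r \<theta> \<theta>')"
    if "r \<in> {0..<1}" for r
    using that kernel[of "of_real r"] poisson_function_of_real[OF \<theta> \<phi>', of r]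
    by (simp add: poisson_kernel_def)
  have cauchy: "(\<lambda>i. norm (cauchy_term Y \<zeta> \<theta>' z \<theta> i)) summable_on cauchy_index TYPE('d) \<and>
        cauchy_kernel Y \<zeta> \<theta>' z \<theta> =
          1 / (1 - \<zeta>\<^sup>2 * z\<^sup>2) * complex_poisson_kernel M (\<zeta> * z) \<theta> \<theta>' \<and>
        cauchy_kernel Y \<zeta> \<theta>' z \<theta> =
          of_real (1 / ?m) * (1 / disc_power ?q (CARD('d) / 2) (\<zeta> * z))"
    if v: "norm (\<zeta> * z) < 1" for \<zeta> z
  proof -
    let ?v = "\<zeta> * z"
    let ?g = "\<lambda>k l. Y k l \<theta> * cnj (Y k l \<theta>')"
    have term_eq: "cauchy_term Y \<zeta> \<theta>' z \<theta> = (\<lambda>(j, k, l). ?v ^ (2 * j + k) * ?g k l)"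
      by (simp add: cauchy_term_def fun_eq_iff power_mult_distrib mult_ac)
    have "(\<lambda>k. ?v ^ k * (\<Sum>l\<in>?I k. ?g k l)) sums (of_real (1 / ?m) * ?p ?v)"
      using coeff_sums[OF v] by (simp only: addition)
    note series = triple_series[OF v orthonormal_product_summable[OF d Y \<theta> norm_ge_zero v] this]
    \<comment> \<open>The numerator \<open>1 - v^2\<close> of the closed form cancels against the
      geometric factor, which requires \<open>v^2 \<noteq> 1\<close>.\<close>
    have nz: "1 - ?v\<^sup>2 \<noteq> 0"
    proof
      assume "1 - ?v\<^sup>2 = 0"
      then have "norm (?v\<^sup>2) = 1"
        by (metis eq_iff_diff_eq_0 norm_one)
      moreover have "norm (?v\<^sup>2) < 1"
        unfolding norm_power using v by (simp only: abs_square_less_1 abs_norm_cancel)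
      ultimately show False
        by simp
    qed
    have v2: "\<zeta>\<^sup>2 * z\<^sup>2 = ?v\<^sup>2"
      by (simp add: power_mult_distrib)
    have kernel_eq: "cauchy_kernel Y \<zeta> \<theta>' z \<theta> = 1 / (1 - ?v\<^sup>2) * (of_real (1 / ?m) * ?p ?v)"
      unfolding cauchy_kernel_def term_eq cauchy_index_def by (rule series(2))
    show ?thesis
    proof (intro conjI)
      show "(\<lambda>i. norm (cauchy_term Y \<zeta> \<theta>' z \<theta> i)) summable_on cauchy_index TYPE('d)"
        unfolding term_eq cauchy_index_def by (rule series(1))
      show "cauchy_kernel Y \<zeta> \<theta>' z \<theta> = 1 / (1 - \<zeta>\<^sup>2 * z\<^sup>2) * complex_poisson_kernel M ?v \<theta> \<theta>'"
        unfolding kernel_eq kernel[OF v] v2 ..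
      show "cauchy_kernel Y \<zeta> \<theta>' z \<theta> = of_real (1 / ?m) * (1 / disc_power ?q (CARD('d) / 2) ?v)"
        unfolding kernel_eq closed[OF v, symmetric] using nz by simp
    qed
  qed
  have expansions: "(\<lambda>k. \<Sum>l\<in>?I k. w ^ k * Y k l \<theta> * cnj (Y k l \<theta>'))
        sums (of_real (1 / ?m) * ((1 - w\<^sup>2) / disc_power ?q (CARD('d) / 2) w)) \<and>
      (\<lambda>k. w ^ k * zonal M k \<theta> \<theta>')
        sums (of_real (1 / ?m) * ((1 - w\<^sup>2) / disc_power ?q (CARD('d) / 2) w))" if "norm w < 1" for w
    unfolding closed[OF that] using harmonic_sums[OF that] zonal_sums[OF that] ..
  have closed_forms: "complex_poisson_kernel M w \<theta> \<theta>' =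
        of_real (1 / ?m) * ((1 - w\<^sup>2) / disc_power ?q (CARD('d) / 2) w) \<and>
      complex_poisson_kernel M w \<theta> \<theta>' = of_real (1 / ?m) * ((1 - w\<^sup>2) /
        disc_power (\<lambda>u. (1 - exp (\<i> * of_real \<phi>) * u) * (1 - exp (- (\<i> * of_real \<phi>)) * u)) (CARD('d) / 2) w)"
    if "norm w < 1" for w
    unfolding closed[OF that] closed'[OF that] kernel[OF that] by simp
  show ?thesis
    by (intro conjI[OF _ conjI[OF _ conjI[OF _ conjI[OF _ conjI[OF _ conjI]]]]] allI impI ballI
        expansions two many holomorphic real closed_forms cauchy)
qed

end
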